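(* Let $X$ and $Y$ be complex Banach spaces. The mapping $\Phi:\mathcal{H}L_0(B_X,Y)\to\mathcal{H}^\infty_s(B_X,\mathcal{L}(X,Y))$ given by $\Phi(f)=df$ is an isometric isomorphism.
   Context: $B_X$ is the open unit ball of $X$ and $\mathcal{L}(X,Y)$ is the Banach space of continuous linear maps from $X$ to $Y$ with the operator norm. For a complex Banach space $Z$, a map $f:B_X\to Z$ is holomorphic if it is (complex) Fréchet differentiable at every point of $B_X$; its differential at $x$ is the continuous complex-linear map $df(x):X\to Z$. $\mathcal{H}^\infty(B_X,Z)$ is the Banach space of bounded holomorphic maps $f:B_X\to Z$ with norm $\|f\|=\sup_{x\in B_X}\|f(x)\|$. $\mathcal{H}L_0(B_X,Y)$ is the Banach space of all $f\in\mathcal{H}^\infty(B_X,Y)$ which are Lipschitz and satisfy $f(0)=0$, with norm $L(f)=\sup\{\|f(x)-f(y)\|/\|x-y\| : x\ne y\in B_X\}$. For a map $g:B_X\to\mathcal{L}(X,Y)$ and $x\in X$, $x\circ g:B_X\to Y$ denotes the function $u\mapsto g(u)(x)$. In particular, for holomorphic $g$ and $x,y\in X$, $y\circ d(x\circ g)$ is the function $u\mapsto d(x\circ g)(u)(y)$. Define $$\mathcal{H}^\infty_s(B_X,\mathcal{L}(X,Y))=\{g\in\mathcal{H}^\infty(B_X,\mathcal{L}(X,Y)) : y\circ d(x\circ g)=x\circ d(y\circ g)\ \text{ for all } x,y\in X\},$$ endowed with the norm inherited from $\mathcal{H}^\infty(B_X,\mathcal{L}(X,Y))$. An isometric isomorphism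 is a surjective linear isometry. *)

theory Defs
  imports "HOL-Analysis.Analysis"
begin

section \<open>Complex Banach spaces\<close>

class complex_normed_vector = real_normed_vector +
  fixes scaleC :: "complex \<Rightarrow> 'a \<Rightarrow> 'a"  (infixr "*\<^sub>C" 75)
  assumes scaleC_add_right: "a *\<^sub>C (x + y) = a *\<^sub>C x + a *\<^sub>C y"
    and scaleC_add_left: "(a + b) *\<^sub>C x = a *\<^sub>C x + b *\<^sub>C x"
    and scaleC_scaleC: "a *\<^sub>C b *\<^sub>C x = (a * b) *\<^sub>C x"
    and scaleC_of_real: "complex_of_real r *\<^sub>C x = r *\<^sub>R x"
    and norm_scaleC: "norm (a *\<^sub>C x) = cmod a * norm x"

class complex_banach = complex_normed_vector + complete_space

subclass (in complex_banach) banach ..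

lemma scaleC_zero_right [simp]: "c *\<^sub>C (0::'a::complex_normed_vector) = 0"
  using norm_scaleC[of c "0::'a"] by simp


section \<open>Continuous complex-linear maps\<close>

text \<open>Realised as the real-bounded-linear maps that commute with complex scalars; the operator norm
  is inherited from the type of bounded linear functions and does not depend on the scalar field.\<close>

typedef (overloaded) ('a, 'b) cblinfun (\<open>(_ \<Rightarrow>\<^sub>C\<^sub>L /_)\<close> [22, 21] 21) =
  "{f :: 'a::complex_normed_vector \<Rightarrow>\<^sub>L 'b::complex_normed_vector.
      \<forall>c x. blinfun_apply f (c *\<^sub>C x) = c *\<^sub>C blinfun_apply f x}"
  morphisms blinfun_of_cblinfun Abs_cblinfun
  by (rule exI[of _ 0]) simp

setup_lifting type_definition_cblinfun

lift_definition cblinfun_apply ::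
  "('a::complex_normed_vector \<Rightarrow>\<^sub>C\<^sub>L 'b::complex_normed_vector) \<Rightarrow> 'a \<Rightarrow> 'b" is blinfun_apply .

lemma scaleC_minus_right: "c *\<^sub>C (- x) = - (c *\<^sub>C (x::'a::complex_normed_vector))"
  using scaleC_add_right[of c x "- x"] by (simp add: eq_neg_iff_add_eq_0 add.commute)

lemma scaleC_diff_right: "c *\<^sub>C (x - y) = c *\<^sub>C x - c *\<^sub>C (y::'a::complex_normed_vector)"
  using scaleC_add_right[of c x "- y"] by (simp add: scaleC_minus_right)

lemma scaleC_scaleR_commute: "c *\<^sub>C r *\<^sub>R x = r *\<^sub>R c *\<^sub>C (x::'a::complex_normed_vector)"
  by (simp add: scaleC_of_real[symmetric] scaleC_scaleC mult.commute)

lemma bounded_linear_scaleC: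
  "bounded_linear (\<lambda>x::'a::complex_normed_vector. c *\<^sub>C x)"
  by (rule bounded_linear_intro[where K = "cmod c"])
    (simp_all add: scaleC_add_right scaleC_scaleR_commute norm_scaleC mult.commute)

lemma cblinfun_eqI: "(\<And>x. cblinfun_apply f x = cblinfun_apply g x) \<Longrightarrow> f = g"
  by transfer (rule blinfun_eqI)

instantiation cblinfun :: (complex_normed_vector, complex_normed_vector) complex_normed_vector
begin

lift_definition norm_cblinfun :: "'a \<Rightarrow>\<^sub>C\<^sub>L 'b \<Rightarrow> real" is norm .

lift_definition zero_cblinfun :: "'a \<Rightarrow>\<^sub>C\<^sub>L 'b" is 0
  by simp

lift_definition plus_cblinfun :: "'a \<Rightarrow>\<^sub>C\<^sub>L 'b \<Rightarrow> 'a \<Rightarrow>\<^sub>C\<^sub>L 'b \<Rightarrow> 'a \<Rightarrow>\<^sub>C\<^sub>L 'b" is "(+)"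
  by (simp add: blinfun.add_left scaleC_add_right)

lift_definition minus_cblinfun :: "'a \<Rightarrow>\<^sub>C\<^sub>L 'b \<Rightarrow> 'a \<Rightarrow>\<^sub>C\<^sub>L 'b \<Rightarrow> 'a \<Rightarrow>\<^sub>C\<^sub>L 'b" is "(-)"
  by (simp add: blinfun.diff_left scaleC_diff_right)

lift_definition uminus_cblinfun :: "'a \<Rightarrow>\<^sub>C\<^sub>L 'b \<Rightarrow> 'a \<Rightarrow>\<^sub>C\<^sub>L 'b" is uminus
  by (simp add: blinfun.minus_left scaleC_minus_right)

lift_definition scaleR_cblinfun :: "real \<Rightarrow> 'a \<Rightarrow>\<^sub>C\<^sub>L 'b \<Rightarrow> 'a \<Rightarrow>\<^sub>C\<^sub>L 'b" is "(*\<^sub>R)"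
  by (simp add: blinfun.scaleR_left scaleC_scaleR_commute)

lift_definition scaleC_cblinfun :: "complex \<Rightarrow> 'a \<Rightarrow>\<^sub>C\<^sub>L 'b \<Rightarrow> 'a \<Rightarrow>\<^sub>C\<^sub>L 'b"
  is "\<lambda>c f. Blinfun (\<lambda>x. c *\<^sub>C blinfun_apply f x)"
  by (simp add: bounded_linear_Blinfun_apply bounded_linear_compose[OF bounded_linear_scaleC]
      blinfun.bounded_linear_right scaleC_scaleC mult.commute)

definition dist_cblinfun :: "'a \<Rightarrow>\<^sub>C\<^sub>L 'b \<Rightarrow> 'a \<Rightarrow>\<^sub>C\<^sub>L 'b \<Rightarrow> real"
  where "dist_cblinfun f g = norm (f - g)"

definition sgn_cblinfun :: "'a \<Rightarrow>\<^sub>C\<^sub>L 'b \<Rightarrow> 'a \<Rightarrow>\<^sub>C\<^sub>L 'b"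
  where "sgn_cblinfun f = inverse (norm f) *\<^sub>R f"

definition uniformity_cblinfun :: "(('a \<Rightarrow>\<^sub>C\<^sub>L 'b) \<times> ('a \<Rightarrow>\<^sub>C\<^sub>L 'b)) filter"
  where "uniformity_cblinfun = (INF e\<in>{0<..}. principal {(x, y). dist x y < e})"

definition open_cblinfun :: "('a \<Rightarrow>\<^sub>C\<^sub>L 'b) set \<Rightarrow> bool"
  where "open_cblinfun S = (\<forall>x\<in>S. \<forall>\<^sub>F (x', y) in uniformity. x' = x \<longrightarrow> y \<in> S)"

lemma scaleC_cblinfun_apply: "cblinfun_apply (c *\<^sub>C f) x = c *\<^sub>C cblinfun_apply f x"
  by transfer
    (simp add: bounded_linear_Blinfun_apply bounded_linear_compose[OF bounded_linear_scaleC]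
      blinfun.bounded_linear_right)

lemma plus_cblinfun_apply: "cblinfun_apply (f + g) x = cblinfun_apply f x + cblinfun_apply g x"
  by transfer (simp add: blinfun.add_left)

lemma scaleR_cblinfun_apply: "cblinfun_apply (r *\<^sub>R f) x = r *\<^sub>R cblinfun_apply f x"
  by transfer (simp add: blinfun.scaleR_left)

instance
proof
  fix f g h :: "'a \<Rightarrow>\<^sub>C\<^sub>L 'b" and a b :: complex and r s :: real and S :: "('a \<Rightarrow>\<^sub>C\<^sub>L 'b) set"
  show "f + g + h = f + (g + h)" "f + g = g + f" "0 + f = f" "- f + f = 0" "f - g = f + - g"
    by (transfer, simp add: algebra_simps)+
  show "r *\<^sub>R (f + g) = r *\<^sub>R f + r *\<^sub>R g" "(r + s) *\<^sub>R f = r *\<^sub>R f + s *\<^sub>R f"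
    "r *\<^sub>R s *\<^sub>R f = (r * s) *\<^sub>R f" "1 *\<^sub>R f = f"
    by (transfer, simp add: scaleR_add_right scaleR_add_left)+
  show "dist f g = norm (f - g)" "sgn f = inverse (norm f) *\<^sub>R f"
    by (simp_all add: dist_cblinfun_def sgn_cblinfun_def)
  show "(uniformity :: (('a \<Rightarrow>\<^sub>C\<^sub>L 'b) \<times> ('a \<Rightarrow>\<^sub>C\<^sub>L 'b)) filter)
      = (INF e\<in>{0<..}. principal {(x, y). dist x y < e})"
    by (rule uniformity_cblinfun_def)
  show "open S = (\<forall>x\<in>S. \<forall>\<^sub>F (x', y) in uniformity. x' = x \<longrightarrow> y \<in> S)"
    by (rule open_cblinfun_def)
  show "norm f = 0 \<longleftrightarrow> f = 0"
    by transfer simp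
  show "norm (f + g) \<le> norm f + norm g"
    by transfer (rule norm_triangle_ineq)
  show "norm (r *\<^sub>R f) = \<bar>r\<bar> * norm f"
    by transfer simp
  show "a *\<^sub>C (f + g) = a *\<^sub>C f + a *\<^sub>C g" "(a + b) *\<^sub>C f = a *\<^sub>C f + b *\<^sub>C f"
    "a *\<^sub>C b *\<^sub>C f = (a * b) *\<^sub>C f" "complex_of_real r *\<^sub>C f = r *\<^sub>R f"
    by (rule cblinfun_eqI; simp add: scaleC_cblinfun_apply plus_cblinfun_apply
        scaleR_cblinfun_apply scaleC_add_right scaleC_add_left scaleC_scaleC scaleC_of_real)+
  have le: "norm (c *\<^sub>C k) \<le> cmod c * norm k" for c and k :: "'a \<Rightarrow>\<^sub>C\<^sub>L 'b"
    by transfer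
      (auto intro!: norm_blinfun_bound mult_left_mono norm_blinfun
        simp: norm_scaleC bounded_linear_Blinfun_apply mult.assoc
          bounded_linear_compose[OF bounded_linear_scaleC] blinfun.bounded_linear_right)
  show "norm (a *\<^sub>C f) = cmod a * norm f"
  proof (cases "a = 0")
    case True
    have "norm (a *\<^sub>C f) \<ge> 0" by transfer simp
    with le[of a f] True show ?thesis by simp
  next
    case False
    have "inverse a *\<^sub>C a *\<^sub>C f = f"
      by (rule cblinfun_eqI)
        (use False scaleC_of_real[of 1] in \<open>simp add: scaleC_cblinfun_apply scaleC_scaleC\<close>)
    with le[of "inverse a" "a *\<^sub>C f"] have "norm f \<le> inverse (cmod a) * norm (a *\<^sub>C f)"
      by (simp add: norm_inverse)
    then have "cmod a * norm f \<le> norm (a *\<^sub>C f)"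
      using False by (simp add: field_simps)
    with le[of a f] show ?thesis by simp
  qed
qed

end

instance cblinfun :: (complex_normed_vector, complex_banach) complex_banach
proof
  fix X :: "nat \<Rightarrow> 'a \<Rightarrow>\<^sub>C\<^sub>L 'b"
  have dist_eq: "dist (blinfun_of_cblinfun f) (blinfun_of_cblinfun g) = dist f g"
    for f g :: "'a \<Rightarrow>\<^sub>C\<^sub>L 'b"
    by (simp add: dist_norm norm_cblinfun.rep_eq minus_cblinfun.rep_eq)
  assume "Cauchy X"
  then have "Cauchy (\<lambda>n. blinfun_of_cblinfun (X n))"
    by (simp add: Cauchy_def dist_eq)
  then obtain L where L: "(\<lambda>n. blinfun_of_cblinfun (X n)) \<longlonglongrightarrow> L"
    using Cauchy_convergent convergent_def by blast
  have ptw: "(\<lambda>n. blinfun_apply (blinfun_of_cblinfun (X n)) x) \<longlonglongrightarrow> blinfun_apply L x" for x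
    by (intro blinfun.tendsto L tendsto_const)
  have "blinfun_apply L (c *\<^sub>C x) = c *\<^sub>C blinfun_apply L x" for c x
  proof (rule LIMSEQ_unique[OF ptw])
    have "blinfun_apply (blinfun_of_cblinfun (X n)) (c *\<^sub>C x)
        = c *\<^sub>C blinfun_apply (blinfun_of_cblinfun (X n)) x" for n
      using blinfun_of_cblinfun[of "X n"] by simp
    then show "(\<lambda>n. blinfun_apply (blinfun_of_cblinfun (X n)) (c *\<^sub>C x))
        \<longlonglongrightarrow> c *\<^sub>C blinfun_apply L x"
      by (simp add: bounded_linear.tendsto[OF bounded_linear_scaleC] ptw)
  qed
  then have "blinfun_of_cblinfun (Abs_cblinfun L) = L"
    by (intro Abs_cblinfun_inverse) simp
  with L have "(\<lambda>n. blinfun_of_cblinfun (X n)) \<longlonglongrightarrow> blinfun_of_cblinfun (Abs_cblinfun L)"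
    by simp
  then have "X \<longlonglongrightarrow> Abs_cblinfun L"
    by (simp only: lim_sequentially dist_eq)
  then show "convergent X"
    by (auto simp: convergent_def)
qed


section \<open>Holomorphic maps on the open unit ball\<close>

text \<open>A map \<open>B_X \<rightarrow> Z\<close> is represented by a total function that vanishes outside the open unit ball
  \<open>ball 0 1\<close>, so that equality and the pointwise vector space operations of such total functions are
  those of maps on the ball.\<close>

definition ball_map :: "('a::real_normed_vector \<Rightarrow> 'z::zero) \<Rightarrow> bool" where
  "ball_map f \<longleftrightarrow> (\<forall>x. x \<notin> ball 0 1 \<longrightarrow> f x = 0)"

text \<open>Since \<open>D\<close> ranges over continuous complex-linear maps, this is complex Frechet
  differentiability.\<close>

definition holomorphic_ball ::
  "('a::complex_normed_vector \<Rightarrow> 'z::complex_normed_vector) \<Rightarrow> bool" where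
  "holomorphic_ball f \<longleftrightarrow>
    (\<forall>x\<in>ball 0 1. \<exists>D :: 'a \<Rightarrow>\<^sub>C\<^sub>L 'z. (f has_derivative cblinfun_apply D) (at x))"

definition differential ::
  "('a::complex_normed_vector \<Rightarrow> 'z::complex_normed_vector) \<Rightarrow> 'a \<Rightarrow> 'a \<Rightarrow>\<^sub>C\<^sub>L 'z" where
  "differential f x =
    (if x \<in> ball 0 1 then (THE D. (f has_derivative cblinfun_apply D) (at x)) else 0)"

lemma differential_eqI:
  assumes "x \<in> ball 0 1" and "(f has_derivative cblinfun_apply D) (at x)"
  shows "differential f x = D"
proof -
  have "D' = D" if "(f has_derivative cblinfun_apply D') (at x)" for D'
    by (rule cblinfun_eqI, rule fun_cong[OF has_derivative_unique[OF that assms(2)]])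
  with assms(2) have "(THE D. (f has_derivative cblinfun_apply D) (at x)) = D"
    by (rule the_equality)
  then show ?thesis
    unfolding differential_def using assms(1) by (simp only: if_True)
qed

definition Hinf :: "('a::complex_normed_vector \<Rightarrow> 'z::complex_normed_vector) set" where
  "Hinf = {f. ball_map f \<and> holomorphic_ball f \<and> bounded (f ` ball 0 1)}"

definition Hinf_norm :: "('a::complex_normed_vector \<Rightarrow> 'z::complex_normed_vector) \<Rightarrow> real" where
  "Hinf_norm f = (SUP x\<in>ball 0 1. norm (f x))"

definition HL0 :: "('a::complex_normed_vector \<Rightarrow> 'b::complex_normed_vector) set" where
  "HL0 = {f \<in> Hinf. (\<exists>C. C-lipschitz_on (ball 0 1) f) \<and> f 0 = 0}"

text \<open>Inserting \<open>0\<close> only matters when the domain is the zero space: the set of difference quotients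
  is then empty, and its supremum is to be read as \<open>0\<close>.\<close>

definition Lip_norm :: "('a::complex_normed_vector \<Rightarrow> 'b::complex_normed_vector) \<Rightarrow> real" where
  "Lip_norm f = Sup (insert 0
     {norm (f x - f y) / norm (x - y) | x y. x \<in> ball 0 1 \<and> y \<in> ball 0 1 \<and> x \<noteq> y})"

text \<open>\<open>eval_comp x g\<close> is the function \<open>x \<circ> g\<close>, where \<open>x\<close> acts on operators by evaluation.\<close>

definition eval_comp ::
  "'a::complex_normed_vector \<Rightarrow> ('a \<Rightarrow> ('a \<Rightarrow>\<^sub>C\<^sub>L 'b::complex_normed_vector)) \<Rightarrow> 'a \<Rightarrow> 'b" where
  "eval_comp x g = (\<lambda>u. cblinfun_apply (g u) x)"

definition Hinf_s ::
  "('a::complex_normed_vector \<Rightarrow> ('a \<Rightarrow>\<^sub>C\<^sub>L 'b::complex_normed_vector)) set" where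
  "Hinf_s = {g \<in> Hinf. \<forall>x y.
     eval_comp y (differential (eval_comp x g)) = eval_comp x (differential (eval_comp y g))}"


section \<open>Isometric isomorphisms of normed function spaces\<close>

definition isometric_isomorphism ::
  "('a \<Rightarrow> 'z::complex_normed_vector) set \<Rightarrow> (('a \<Rightarrow> 'z) \<Rightarrow> real) \<Rightarrow>
   ('a \<Rightarrow> 'w::complex_normed_vector) set \<Rightarrow> (('a \<Rightarrow> 'w) \<Rightarrow> real) \<Rightarrow>
   (('a \<Rightarrow> 'z) \<Rightarrow> ('a \<Rightarrow> 'w)) \<Rightarrow> bool" where
  "isometric_isomorphism V normV W normW T \<longleftrightarrow>
     (\<forall>f\<in>V. T f \<in> W) \<and>
     (\<forall>f\<in>V. \<forall>g\<in>V. T (\<lambda>x. f x + g x) = (\<lambda>x. T f x + T g x)) \<and>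
     (\<forall>c. \<forall>f\<in>V. T (\<lambda>x. c *\<^sub>C f x) = (\<lambda>x. c *\<^sub>C T f x)) \<and>
     (\<forall>f\<in>V. normW (T f) = normV f) \<and>
     (\<forall>g\<in>W. \<exists>f\<in>V. T f = g)"

end

theory Submission
  imports Defs
begin

text \<open>Write \<open>B\<close> for the open unit ball of \<open>X\<close>. A derivative is bounded by any Lipschitz constant,
  and the mean value inequality is the converse, so on the convex set \<open>B\<close> the best Lipschitz
  constant of \<open>f\<close> is the supremum of \<open>\<parallel>df\<parallel>\<close>
  (\<open>Hinf_norm_differential\<close>). Two facts remain, and both need Cauchy theory for vector-valued
  maps.

  \<^item> If \<open>f\<close> is holomorphic and Lipschitz, then \<open>df\<close> is again Frechet differentiable, in the operator
    norm (\<open>derivative_of_lipschitz_holomorphic\<close>). The symmetry condition on \<open>df\<close> is then the symmetry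
    of second derivatives (\<open>second_derivative_symmetric\<close>).
  \<^item> If \<open>g\<close> is bounded, holomorphic and satisfies the symmetry condition, then \<open>g = df\<close> for some
    \<open>f\<close>; this \<open>f\<close> is Lipschitz because \<open>g\<close> is bounded.

  One theorem gives the analytic core of both. Regard a map \<open>\<omega>\<close> from a convex subset of a real
  normed space to bounded linear maps as a 1-form. If \<open>\<omega>\<close> is differentiable with symmetric
  derivative, then the form is closed, and Goursat's bisection argument shows that its integral over
  every triangle vanishes. Bisection serves here because the derivative of a holomorphic map is not
  yet known to be continuous. Integrating from a base point gives a primitive of \<open>\<omega>\<close>
  (\<open>symmetric_derivative_imp_primitive\<close>). Applied to \<open>\<omega> = g\<close> this is surjectivity.

  Applied to the form \<open>w \<mapsto> w h(z)\<close> on a convex subset of the complex plane it gives a primitive of every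
  complex differentiable vector-valued \<open>h\<close>. For \<open>e\<^sup>-\<^sup>z h(e\<^sup>z)\<close> on a left half plane, where \<open>e\<^sup>z\<close>
  covers a punctured disc, the increment of the primitive over the period \<open>2 \<pi> \<i>\<close> is constant. The
  increment is a circle integral, and its limit for shrinking radius is determined by \<open>h'(0)\<close>.
  This is Cauchy's formula for \<open>h'(0)\<close> (\<open>Cauchy_derivative_formula\<close>), and it expresses \<open>df(v)(y)\<close>
  as a weighted average of values of \<open>f\<close> on the circle \<open>v + r e\<^sup>i\<^sup>\<theta> y\<close>. A Lipschitz bound for \<open>f\<close>
  thus passes to \<open>df\<close>, hence \<open>f\<close> has a locally uniform quadratic Taylor remainder; inserting that
  remainder in the same formula differentiates \<open>df\<close>, uniformly in \<open>\<parallel>y\<parallel> \<le> 1\<close>.\<close>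

section \<open>Line integrals of operator-valued 1-forms\<close>

definition line_integral ::
  "('a::real_normed_vector \<Rightarrow> 'a \<Rightarrow>\<^sub>L 'b::banach) \<Rightarrow> 'a \<Rightarrow> 'a \<Rightarrow> 'b" where
  "line_integral \<omega> a b = integral {0..1} (\<lambda>t. blinfun_apply (\<omega> (a + t *\<^sub>R (b - a))) (b - a))"

lemma in_closed_segment_param:
  "t \<in> {0..1} \<Longrightarrow> a + t *\<^sub>R (b - a) \<in> closed_segment a b"
  by (auto simp: closed_segment_def algebra_simps intro!: exI[of _ t])

lemma continuous_on_pullback_segment:
  fixes \<omega> :: "'a::real_normed_vector \<Rightarrow> 'a \<Rightarrow>\<^sub>L 'b::real_normed_vector"
  assumes "continuous_on (closed_segment a b) \<omega>"
  shows "continuous_on {0..1} (\<lambda>t. blinfun_apply (\<omega> (a + t *\<^sub>R (b - a))) v)"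
proof -
  have "continuous_on {0..1} (\<lambda>t::real. \<omega> (a + t *\<^sub>R (b - a)))"
  proof (rule continuous_on_compose2[OF assms])
    show "continuous_on {0..1} (\<lambda>t::real. a + t *\<^sub>R (b - a))" by (intro continuous_intros)
  qed (auto intro: in_closed_segment_param)
  then show ?thesis by (intro continuous_intros)
qed

lemma has_line_integral:
  assumes "continuous_on (closed_segment a b) \<omega>"
  shows "((\<lambda>t. blinfun_apply (\<omega> (a + t *\<^sub>R (b - a))) (b - a)) has_integral line_integral \<omega> a b) {0..1}"
  unfolding line_integral_def
  by (intro integrable_integral integrable_continuous_real continuous_on_pullback_segment assms)

lemma norm_line_integral_le:
  assumes cont: "continuous_on (closed_segment a b) \<omega>"
    and B: "\<And>x. x \<in> closed_segment a b \<Longrightarrow> norm (\<omega> x) \<le> B"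
  shows "norm (line_integral \<omega> a b) \<le> B * norm (b - a)"
proof -
  have "0 \<le> B" using order_trans[OF norm_ge_zero B[of a]] by simp
  then have "norm (line_integral \<omega> a b) \<le> (B * norm (b - a)) * measure lborel {0..1::real}"
    by (intro has_integral_bound_real[OF _ finite.emptyI has_line_integral[OF cont]])
      (auto intro!: order_trans[OF norm_blinfun] mult_right_mono B in_closed_segment_param)
  then show ?thesis by simp
qed

lemma line_integral_diff:
  assumes "continuous_on (closed_segment a b) \<omega>" "continuous_on (closed_segment a b) \<eta>"
  shows "line_integral (\<lambda>x. \<omega> x - \<eta> x) a b = line_integral \<omega> a b - line_integral \<eta> a b"
  using has_integral_diff[OF has_line_integral[OF assms(1)] has_line_integral[OF assms(2)]]
  unfolding line_integral_def by (simp add: blinfun.diff_left integral_unique)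

lemma line_integral_exact:
  assumes F: "\<And>x. x \<in> closed_segment a b \<Longrightarrow>
      (F has_derivative blinfun_apply (\<omega> x)) (at x within closed_segment a b)"
  shows "line_integral \<omega> a b = F b - F a"
proof -
  let ?p = "\<lambda>t::real. a + t *\<^sub>R (b - a)"
  have "((\<lambda>t. F (?p t)) has_vector_derivative blinfun_apply (\<omega> (?p t)) (b - a)) (at t within {0..1})"
    if t: "t \<in> {0..1}" for t
  proof -
    have p: "(?p has_derivative (\<lambda>h. h *\<^sub>R (b - a))) (at t within {0..1})"
      by (auto intro!: derivative_eq_intros)
    have "(F has_derivative blinfun_apply (\<omega> (?p t))) (at (?p t) within ?p ` {0..1})"
      by (rule has_derivative_subset[OF F]) (use t in \<open>auto intro: in_closed_segment_param\<close>)
    from diff_chain_within[OF p this] show ?thesis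
      by (simp add: has_vector_derivative_def o_def blinfun.scaleR_right)
  qed
  then have "((\<lambda>t. blinfun_apply (\<omega> (?p t)) (b - a)) has_integral (F (?p 1) - F (?p 0))) {0..1}"
    by (intro fundamental_theorem_of_calculus) auto
  then show ?thesis
    unfolding line_integral_def by (simp add: integral_unique)
qed

text \<open>On a fixed segment a line integral is an ordinary integral of one real variable, so an
  antiderivative \<open>\<Phi>\<close> of the pulled-back integrand computes the integrals over all subsegments, in
  either direction. Reversal and bisection are special cases.\<close>

lemma line_integral_subsegment:
  assumes cont: "continuous_on (closed_segment a b) \<omega>"
  obtains \<Phi> where "\<And>s r. s \<in> {0..1} \<Longrightarrow> r \<in> {0..1} \<Longrightarrow>
    line_integral \<omega> (a + s *\<^sub>R (b - a)) (a + r *\<^sub>R (b - a)) = \<Phi> r - \<Phi> s"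
proof -
  let ?p = "\<lambda>t::real. a + t *\<^sub>R (b - a)"
  obtain \<Phi> where \<Phi>: "\<And>t. t \<in> {0..1} \<Longrightarrow>
      (\<Phi> has_vector_derivative blinfun_apply (\<omega> (?p t)) (b - a)) (at t within {0..1})"
    using antiderivative_continuous[OF continuous_on_pullback_segment[OF cont]] by blast
  have "line_integral \<omega> (?p s) (?p r) = \<Phi> r - \<Phi> s" if s: "s \<in> {0..1}" and r: "r \<in> {0..1}" for s r
  proof -
    let ?q = "\<lambda>t::real. s + t * (r - s)"
    have q: "?q t \<in> {0..1}" if "t \<in> {0..1}" for t
      using in_closed_segment_param[OF that, of s r] s r
        closed_segment_subset[of s "{0..1}" r] by auto
    have "((\<lambda>t. \<Phi> (?q t)) has_vector_derivative
        blinfun_apply (\<omega> (?p s + t *\<^sub>R (?p r - ?p s))) (?p r - ?p s)) (at t within {0..1})"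
      if t: "t \<in> {0..1}" for t
    proof -
      have 1: "(?q has_vector_derivative (r - s)) (at t within {0..1})"
        unfolding has_vector_derivative_def by (rule derivative_eq_intros refl)+ simp
      have 2: "(\<Phi> has_vector_derivative blinfun_apply (\<omega> (?p (?q t))) (b - a))
          (at (?q t) within ?q ` {0..1})"
        by (rule has_vector_derivative_within_subset[OF \<Phi>[OF q[OF t]]]) (use q in blast)
      have 3: "?p s + t *\<^sub>R (?p r - ?p s) = ?p (?q t)" "?p r - ?p s = (r - s) *\<^sub>R (b - a)"
        by (simp_all add: algebra_simps)
      show ?thesis
        using vector_diff_chain_within[OF 1 2] unfolding 3(1) unfolding 3(2) by (simp only: o_def blinfun.scaleR_right)
    qed
    then have "((\<lambda>t. blinfun_apply (\<omega> (?p s + t *\<^sub>R (?p r - ?p s))) (?p r - ?p s))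
        has_integral (\<Phi> (?q 1) - \<Phi> (?q 0))) {0..1}"
      by (intro fundamental_theorem_of_calculus) auto
    then show ?thesis
      unfolding line_integral_def by (simp add: integral_unique)
  qed
  then show thesis by (rule that)
qed

lemma line_integral_reverse:
  assumes "continuous_on (closed_segment a b) \<omega>"
  shows "line_integral \<omega> b a = - line_integral \<omega> a b"
proof -
  obtain \<Phi> where \<Phi>: "\<And>s r. s \<in> {0..1} \<Longrightarrow> r \<in> {0..1} \<Longrightarrow>
    line_integral \<omega> (a + s *\<^sub>R (b - a)) (a + r *\<^sub>R (b - a)) = \<Phi> r - \<Phi> s"
    using line_integral_subsegment[OF assms] by blast
  show ?thesis using \<Phi>[of 0 1] \<Phi>[of 1 0] by simp
qed

lemma line_integral_midpoint:
  assumes "continuous_on (closed_segment a b) \<omega>"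
  shows "line_integral \<omega> a b = line_integral \<omega> a (midpoint a b) + line_integral \<omega> (midpoint a b) b"
proof -
  obtain \<Phi> where \<Phi>: "\<And>s r. s \<in> {0..1} \<Longrightarrow> r \<in> {0..1} \<Longrightarrow>
    line_integral \<omega> (a + s *\<^sub>R (b - a)) (a + r *\<^sub>R (b - a)) = \<Phi> r - \<Phi> s"
    using line_integral_subsegment[OF assms] by blast
  have "a + (1/2) *\<^sub>R (b - a) = midpoint a b"
    by (simp add: midpoint_def algebra_simps flip: scaleR_add_left)
  then show ?thesis using \<Phi>[of 0 "1/2"] \<Phi>[of "1/2" 1] \<Phi>[of 0 1] by simp
qed

section \<open>Goursat's theorem and primitives of closed forms\<close>

definition triangle_integral ::
  "('a::real_normed_vector \<Rightarrow> 'a \<Rightarrow>\<^sub>L 'b::banach) \<Rightarrow> 'a \<Rightarrow> 'a \<Rightarrow> 'a \<Rightarrow> 'b" where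
  "triangle_integral \<omega> a b c = line_integral \<omega> a b + line_integral \<omega> b c + line_integral \<omega> c a"

lemma norm_sum4_ge:
  fixes a b c d :: "'a::real_normed_vector"
  assumes "e \<le> norm (a + b + c + d)"
  shows "e / 4 \<le> norm a \<or> e / 4 \<le> norm b \<or> e / 4 \<le> norm c \<or> e / 4 \<le> norm d"
  using assms norm_triangle_ineq[of "a + b + c" d] norm_triangle_ineq[of "a + b" c]
    norm_triangle_ineq[of a b] by linarith

text \<open>The medial subdivision writes the integral over the triangle as the sum over four triangles
  of half the size, the inner edges cancelling; one of the four carries a quarter of the norm.\<close>

lemma triangle_quadrisection:
  assumes cont: "continuous_on (convex hull {a, b, c}) \<omega>"
    and dist: "dist a b \<le> k" "dist b c \<le> k" "dist c a \<le> k"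
    and e: "e * k\<^sup>2 \<le> norm (triangle_integral \<omega> a b c)"
  shows "\<exists>a' b' c'. convex hull {a', b', c'} \<subseteq> convex hull {a, b, c} \<and>
    dist a' b' \<le> k / 2 \<and> dist b' c' \<le> k / 2 \<and> dist c' a' \<le> k / 2 \<and>
    e * (k / 2)\<^sup>2 \<le> norm (triangle_integral \<omega> a' b' c')"
proof -
  define p q r where "p = midpoint b c" "q = midpoint c a" "r = midpoint a b"
  have in_hull: "{a, b, c, p, q, r} \<subseteq> convex hull {a, b, c}"
    by (auto simp: p_q_r_def hull_inc intro!: midpoints_in_convex_hull)
  have seg: "continuous_on (closed_segment x y) \<omega>" if "x \<in> {a, b, c, p, q, r}" "y \<in> {a, b, c, p, q, r}" for x y
    by (rule continuous_on_subset[OF cont], rule closed_segment_subset)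
      (use in_hull that in \<open>auto intro: convex_convex_hull\<close>)
  have sub: "convex hull {x, y, z} \<subseteq> convex hull {a, b, c}"
    if "x \<in> {a, b, c, p, q, r}" "y \<in> {a, b, c, p, q, r}" "z \<in> {a, b, c, p, q, r}" for x y z
    by (rule convex_hull_subset) (use in_hull that in blast)
  have mid: "line_integral \<omega> a b = line_integral \<omega> a r + line_integral \<omega> r b"
    "line_integral \<omega> b c = line_integral \<omega> b p + line_integral \<omega> p c"
    "line_integral \<omega> c a = line_integral \<omega> c q + line_integral \<omega> q a"
    unfolding p_q_r_def by (intro line_integral_midpoint seg; simp)+
  have rev: "line_integral \<omega> p q = - line_integral \<omega> q p" "line_integral \<omega> q r = - line_integral \<omega> r q"
    "line_integral \<omega> r p = - line_integral \<omega> p r"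
    by (intro line_integral_reverse seg; simp)+
  have "triangle_integral \<omega> a b c = triangle_integral \<omega> a r q + triangle_integral \<omega> r b p +
      triangle_integral \<omega> q p c + triangle_integral \<omega> p q r"
    unfolding triangle_integral_def mid rev by (simp add: algebra_simps)
  then have "e * k\<^sup>2 / 4 \<le> norm (triangle_integral \<omega> a r q) \<or> e * k\<^sup>2 / 4 \<le> norm (triangle_integral \<omega> r b p)
    \<or> e * k\<^sup>2 / 4 \<le> norm (triangle_integral \<omega> q p c) \<or> e * k\<^sup>2 / 4 \<le> norm (triangle_integral \<omega> p q r)"
    using e norm_sum4_ge[of "e * k\<^sup>2"] by metis
  moreover have "e * (k / 2)\<^sup>2 = e * k\<^sup>2 / 4" by (simp add: power2_eq_square)
  moreover have d: "dist a r \<le> k/2" "dist r b \<le> k/2" "dist b p \<le> k/2" "dist p c \<le> k/2" "dist c q \<le> k/2" "dist q a \<le> k/2"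
    using dist unfolding p_q_r_def by (simp_all add: dist_midpoint dist_commute)
  have d': "dist (midpoint x y) (midpoint x z) = dist y z / 2" for x y z :: 'a
    by (simp add: dist_norm midpoint_def algebra_simps flip: scaleR_diff_right)
  have d2: "dist q r \<le> k/2" "dist p r \<le> k/2" "dist p q \<le> k/2"
    using dist d'[of a b c] d'[of b c a] d'[of c b a]
    unfolding p_q_r_def by (simp_all add: midpoint_sym dist_commute)
  have dd: "dist a r \<le> k / 2 \<and> dist r q \<le> k / 2 \<and> dist q a \<le> k / 2"
    "dist r b \<le> k / 2 \<and> dist b p \<le> k / 2 \<and> dist p r \<le> k / 2"
    "dist q p \<le> k / 2 \<and> dist p c \<le> k / 2 \<and> dist c q \<le> k / 2"
    "dist p q \<le> k / 2 \<and> dist q r \<le> k / 2 \<and> dist r p \<le> k / 2"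
    using d d2 by (simp_all add: dist_commute)
  have ss: "convex hull {a, r, q} \<subseteq> convex hull {a, b, c}" "convex hull {r, b, p} \<subseteq> convex hull {a, b, c}"
    "convex hull {q, p, c} \<subseteq> convex hull {a, b, c}" "convex hull {p, q, r} \<subseteq> convex hull {a, b, c}"
    by (rule sub; simp)+
  ultimately show ?thesis using dd ss by metis
qed

text \<open>These are the first-order approximations of a closed form at a point. They are exact: a
  primitive is a linear plus a quadratic function, and the symmetry of \<open>D\<close> is what makes the derivative
  of \<open>x \<mapsto> D(x - p)(x - p) / 2\<close> equal to \<open>D(x - p)\<close>.\<close>

lemma triangle_integral_affine_symmetric:
  fixes A :: "'a::real_normed_vector \<Rightarrow>\<^sub>L 'b::banach"
  assumes D: "bounded_linear D" and sym: "\<And>v w. blinfun_apply (D v) w = blinfun_apply (D w) v"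
  shows "triangle_integral (\<lambda>x. A + D (x - p)) a b c = 0"
proof -
  define F where "F x = blinfun_apply A x + (1/2) *\<^sub>R blinfun_apply (D (x - p)) (x - p)" for x
  interpret D: bounded_linear D by fact
  have "(F has_derivative blinfun_apply (A + D (x - p))) (at x within S)" for x S
  proof -
    have 1: "((\<lambda>x. D (x - p)) has_derivative D) (at x within S)"
      by (rule D.has_derivative) (auto intro!: derivative_eq_intros)
    have 2: "((\<lambda>x. x - p) has_derivative (\<lambda>h. h)) (at x within S)"
      by (auto intro!: derivative_eq_intros)
    have 3: "blinfun_apply (D (x - p)) h + blinfun_apply (D h) (x - p) = 2 *\<^sub>R blinfun_apply (D (x - p)) h" for h
      using sym[of h "x - p"] by (simp add: scaleR_2)
    have "(F has_derivative (\<lambda>h. blinfun_apply A h +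
        (1/2) *\<^sub>R (blinfun_apply (D (x - p)) h + blinfun_apply (D h) (x - p)))) (at x within S)"
      unfolding F_def
      by (intro has_derivative_add has_derivative_scaleR_right blinfun.FDERIV 1 2
          bounded_linear_imp_has_derivative blinfun.bounded_linear_right)
    then show ?thesis unfolding 3 by (simp add: blinfun.add_left[abs_def])
  qed
  then have "line_integral (\<lambda>x. A + D (x - p)) x y = F y - F x" for x y
    by (intro line_integral_exact)
  then show ?thesis unfolding triangle_integral_def by simp
qed

text \<open>Goursat's argument. Were the integral nonzero, repeated quadrisection would give nested
  triangles of side at most \<open>K / 2\<^sup>n\<close> with integral at least \<open>e (K / 2\<^sup>n)\<^sup>2\<close> in norm. At their common
  point \<open>p\<close> the form differs from its exact affine approximation by \<open>o(\<parallel>x - p\<parallel>)\<close>, so these integrals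
  are \<open>o((K / 2\<^sup>n)\<^sup>2)\<close>.\<close>

theorem triangle_integral_eq_0:
  fixes \<omega> :: "'a::real_normed_vector \<Rightarrow> 'a \<Rightarrow>\<^sub>L 'b::banach"
  assumes deriv: "\<And>x. x \<in> convex hull {a, b, c} \<Longrightarrow>
      (\<omega> has_derivative D x) (at x within convex hull {a, b, c})"
    and sym: "\<And>x v w. x \<in> convex hull {a, b, c} \<Longrightarrow> blinfun_apply (D x v) w = blinfun_apply (D x w) v"
  shows "triangle_integral \<omega> a b c = 0"
proof (rule ccontr)
  assume nz: "triangle_integral \<omega> a b c \<noteq> 0"
  let ?H = "convex hull {a, b, c}"
  have cont: "continuous_on ?H \<omega>"
    by (rule has_derivative_continuous_on[OF deriv])
  define K where "K = 1 + max (dist a b) (max (dist b c) (dist c a))"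
  have K: "K > 0" "dist a b \<le> K" "dist b c \<le> K" "dist c a \<le> K"
    unfolding K_def using zero_le_dist[of a b] by linarith+
  define e where "e = norm (triangle_integral \<omega> a b c) / K\<^sup>2"
  have e: "e > 0" using nz K by (simp add: e_def)
  define At where "At T n \<longleftrightarrow> (case T of (x, y, z) \<Rightarrow> convex hull {x, y, z} \<subseteq> ?H \<and>
      dist x y \<le> K / 2 ^ n \<and> dist y z \<le> K / 2 ^ n \<and> dist z x \<le> K / 2 ^ n \<and>
      e * (K / 2 ^ n)\<^sup>2 \<le> norm (triangle_integral \<omega> x y z))" for T n
  define hullT where "hullT T = (case T of (x, y, z) \<Rightarrow> convex hull {x, y, z})" for T :: "'a \<times> 'a \<times> 'a"
  have "\<exists>T'. At T' (Suc n) \<and> hullT T' \<subseteq> hullT T" if At: "At T n" for T n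
  proof -
    obtain x y z where T: "T = (x, y, z)" by (cases T)
    have "continuous_on (convex hull {x, y, z}) \<omega>"
      using cont continuous_on_subset At unfolding At_def T by blast
    then obtain x' y' z' where "convex hull {x', y', z'} \<subseteq> convex hull {x, y, z}"
      "dist x' y' \<le> K / 2 ^ n / 2" "dist y' z' \<le> K / 2 ^ n / 2" "dist z' x' \<le> K / 2 ^ n / 2"
      "e * (K / 2 ^ n / 2)\<^sup>2 \<le> norm (triangle_integral \<omega> x' y' z')"
      using triangle_quadrisection[of x y z \<omega> "K / 2 ^ n" e] At unfolding At_def T prod.case by blast
    then show ?thesis using At
      by (intro exI[of _ "(x', y', z')"]) (auto simp: At_def hullT_def T mult.commute)
  qed
  moreover have "At (a, b, c) 0" using K by (simp add: At_def e_def)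
  ultimately obtain T where T: "\<And>n. At (T n) n" "\<And>n. hullT (T (Suc n)) \<subseteq> hullT (T n)"
    using dependent_nat_choice[of "\<lambda>n T. At T n" "\<lambda>n T T'. hullT T' \<subseteq> hullT T"] by metis
  have anti: "hullT (T n) \<subseteq> hullT (T m)" if "m \<le> n" for m n
    using that T(2) by (induction rule: dec_induct) auto
  have in_H: "hullT (T n) \<subseteq> ?H" for n
    using T(1)[of n] by (auto simp: hullT_def At_def split: prod.splits)
  have "?H \<inter> (\<Inter>n\<in>UNIV. hullT (T n)) \<noteq> {}"
  proof (rule compact_imp_fip_image)
    show "compact ?H" by (simp add: finite_imp_compact_convex_hull)
    show "closed (hullT (T n))" for n
      by (auto simp: hullT_def finite_imp_compact_convex_hull compact_imp_closed split: prod.split)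
    fix N :: "nat set" assume "finite N"
    then obtain m where "\<And>n. n \<in> N \<Longrightarrow> n \<le> m" by (meson finite_nat_set_iff_bounded_le)
    then have "hullT (T m) \<subseteq> ?H \<inter> (\<Inter>n\<in>N. hullT (T n))" using anti in_H by blast
    moreover have "hullT (T m) \<noteq> {}" by (auto simp: hullT_def split: prod.split)
    ultimately show "?H \<inter> (\<Inter>n\<in>N. hullT (T n)) \<noteq> {}" by blast
  qed
  then obtain p where p: "\<And>n. p \<in> hullT (T n)" by blast
  have pH: "p \<in> ?H" using p[of 0] T(1)[of 0] by (auto simp: hullT_def At_def split: prod.splits)
  \<comment> \<open>The points of a small triangle of side \<open>k\<close> are within \<open>2 k\<close> of \<open>p\<close>, so an error rate of \<open>e / 12\<close>
    costs at most \<open>3 (e / 12) (2 k) k = e k\<^sup>2 / 2\<close> along the three edges.\<close>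
  obtain d where d: "d > 0" "\<And>x. x \<in> ?H \<Longrightarrow> norm (x - p) < d \<Longrightarrow>
      norm (\<omega> x - \<omega> p - D p (x - p)) \<le> (e / 12) * norm (x - p)"
    using deriv[OF pH] e unfolding has_derivative_within_alt by (meson divide_pos_pos zero_less_numeral)
  obtain n where n: "2 * K / d < 2 ^ n" using real_arch_pow[of 2] by auto
  define k where "k = K / 2 ^ n"
  have k: "k > 0" "2 * k < d" using K n d(1) by (simp_all add: k_def field_simps)
  obtain x y z where xyz: "T n = (x, y, z)" by (cases "T n")
  have A: "convex hull {x, y, z} \<subseteq> ?H" "dist x y \<le> k" "dist y z \<le> k" "dist z x \<le> k"
    "e * k\<^sup>2 \<le> norm (triangle_integral \<omega> x y z)" and p': "p \<in> convex hull {x, y, z}"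
    using T(1)[of n] p[of n] by (auto simp: At_def xyz k_def hullT_def)
  have "convex hull {x, y, z} \<subseteq> cball x k"
    by (rule hull_minimal) (use A k(1) in \<open>auto simp: dist_commute\<close>)
  then have near: "norm (u - p) \<le> 2 * k" if "u \<in> convex hull {x, y, z}" for u
    using that p' norm_triangle_ineq[of "u - x" "x - p"] by (auto simp: dist_norm norm_minus_commute subset_iff)
      (smt (verit))
  define \<eta> where "\<eta> u = \<omega> p + D p (u - p)" for u
  have D: "bounded_linear (D p)" using deriv[OF pH] has_derivative_bounded_linear by blast
  have \<eta>: "triangle_integral \<eta> x y z = 0"
    unfolding \<eta>_def by (rule triangle_integral_affine_symmetric[OF D sym[OF pH]])
  have cont\<eta>: "continuous_on S \<eta>" for S
    unfolding \<eta>_def by (intro continuous_intros bounded_linear.continuous_on[OF D])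
  have seg: "norm (line_integral (\<lambda>u. \<omega> u - \<eta> u) u v) \<le> e / 6 * k\<^sup>2"
    "line_integral (\<lambda>u. \<omega> u - \<eta> u) u v = line_integral \<omega> u v - line_integral \<eta> u v"
    if uv: "u \<in> {x, y, z}" "v \<in> {x, y, z}" and "dist u v \<le> k" for u v
  proof -
    have sub: "closed_segment u v \<subseteq> convex hull {x, y, z}"
      by (rule closed_segment_subset) (use uv in \<open>auto intro: hull_inc convex_convex_hull\<close>)
    with A(1) have subH: "closed_segment u v \<subseteq> ?H" by blast
    have cont\<omega>: "continuous_on (closed_segment u v) \<omega>"
      by (rule continuous_on_subset[OF cont subH])
    have "norm (\<omega> q - \<eta> q) \<le> e / 6 * k" if q: "q \<in> closed_segment u v" for q
    proof -
      have "norm (q - p) \<le> 2 * k" using near sub q by blast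
      moreover from this have "norm (\<omega> q - \<omega> p - D p (q - p)) \<le> (e / 12) * norm (q - p)"
        using k subH q by (intro d(2)) auto
      moreover have "(e / 12) * norm (q - p) \<le> (e / 12) * (2 * k)"
        using calculation(1) e by (intro mult_left_mono) auto
      ultimately show ?thesis by (simp add: \<eta>_def algebra_simps)
    qed
    then have "norm (line_integral (\<lambda>u. \<omega> u - \<eta> u) u v) \<le> e / 6 * k * norm (v - u)"
      by (intro norm_line_integral_le continuous_on_diff cont\<omega> cont\<eta>)
    also have "\<dots> \<le> e / 6 * k * k"
      using that k e by (intro mult_left_mono) (auto simp: dist_norm norm_minus_commute)
    finally show "norm (line_integral (\<lambda>u. \<omega> u - \<eta> u) u v) \<le> e / 6 * k\<^sup>2"
      by (simp add: power2_eq_square mult.assoc)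
    show "line_integral (\<lambda>u. \<omega> u - \<eta> u) u v = line_integral \<omega> u v - line_integral \<eta> u v"
      by (rule line_integral_diff[OF cont\<omega> cont\<eta>])
  qed
  have "triangle_integral \<omega> x y z = triangle_integral (\<lambda>u. \<omega> u - \<eta> u) x y z"
  proof -
    have "triangle_integral (\<lambda>u. \<omega> u - \<eta> u) x y z = triangle_integral \<omega> x y z - triangle_integral \<eta> x y z"
      using A by (simp add: triangle_integral_def seg(2))
    then show ?thesis by (simp add: \<eta>)
  qed
  also have "norm \<dots> \<le> e / 6 * k\<^sup>2 + e / 6 * k\<^sup>2 + e / 6 * k\<^sup>2"
    unfolding triangle_integral_def
    by (intro order_trans[OF norm_triangle_ineq] add_mono seg(1)) (use A in auto)
  finally have "e * k\<^sup>2 \<le> e * k\<^sup>2 / 2" using A(5) by simp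
  moreover have "e * k\<^sup>2 > 0" using e k by simp
  ultimately show False by linarith
qed

text \<open>The primitive is \<open>x \<mapsto> \<integral> \<omega>\<close> along the segment from a base point to \<open>x\<close>: its increments are
  line integrals because triangle integrals vanish, and its derivative is \<open>\<omega>\<close> because \<open>\<omega>\<close> is
  continuous.\<close>

theorem symmetric_derivative_imp_primitive:
  fixes \<omega> :: "'a::real_normed_vector \<Rightarrow> 'a \<Rightarrow>\<^sub>L 'b::banach"
  assumes S: "convex S"
    and deriv: "\<And>x. x \<in> S \<Longrightarrow> (\<omega> has_derivative D x) (at x within S)"
    and sym: "\<And>x v w. x \<in> S \<Longrightarrow> blinfun_apply (D x v) w = blinfun_apply (D x w) v"
  obtains F where "\<And>x. x \<in> S \<Longrightarrow> (F has_derivative blinfun_apply (\<omega> x)) (at x within S)"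
proof (cases "S = {}")
  case True
  then show thesis using that by blast
next
  case False
  then obtain a where a: "a \<in> S" by blast
  have cont: "continuous_on S \<omega>"
    by (rule has_derivative_continuous_on[OF deriv])
  have contseg: "continuous_on (closed_segment x y) \<omega>" if "x \<in> S" "y \<in> S" for x y
    by (rule continuous_on_subset[OF cont closed_segment_subset]) (use that S in auto)
  have triangle: "line_integral \<omega> a y - line_integral \<omega> a x = line_integral \<omega> x y"
    if xy: "x \<in> S" "y \<in> S" for x y
  proof -
    have sub: "convex hull {a, x, y} \<subseteq> S" by (rule hull_minimal) (use a xy S in auto)
    have "triangle_integral \<omega> a x y = 0"
      by (rule triangle_integral_eq_0[where D = D])
        (use sub in \<open>auto intro: has_derivative_subset[OF deriv] sym\<close>)
    then show ?thesis
      using line_integral_reverse[OF contseg[OF a xy(2)]]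
      by (simp add: triangle_integral_def algebra_simps)
  qed
  have "((\<lambda>x. line_integral \<omega> a x) has_derivative blinfun_apply (\<omega> x)) (at x within S)" if x: "x \<in> S" for x
    unfolding has_derivative_within_alt
  proof (intro conjI allI impI blinfun.bounded_linear_right)
    fix e :: real assume "e > 0"
    then obtain d where d: "d > 0" "\<And>y. y \<in> S \<Longrightarrow> dist y x < d \<Longrightarrow> dist (\<omega> y) (\<omega> x) < e"
      using cont x unfolding continuous_on_iff by blast
    have "norm (line_integral \<omega> a y - line_integral \<omega> a x - blinfun_apply (\<omega> x) (y - x)) \<le> e * norm (y - x)"
      if y: "y \<in> S" "norm (y - x) < d" for y
    proof -
      have seg: "closed_segment x y \<subseteq> S" by (rule closed_segment_subset) (use x y S in auto)
      have near: "dist z x < d" if "z \<in> closed_segment x y" for z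
        using closed_segment_subset[of x "ball x d" y] that y(2) d(1)
        by (auto simp: dist_norm norm_minus_commute subset_iff)
      have "line_integral (\<lambda>_. \<omega> x) x y = blinfun_apply (\<omega> x) y - blinfun_apply (\<omega> x) x"
        by (rule line_integral_exact) (rule bounded_linear_imp_has_derivative[OF blinfun.bounded_linear_right])
      then have "line_integral \<omega> a y - line_integral \<omega> a x - blinfun_apply (\<omega> x) (y - x)
          = line_integral (\<lambda>z. \<omega> z - \<omega> x) x y"
        using line_integral_diff[OF contseg[OF x y(1)] continuous_on_const[of _ "\<omega> x"]]
        by (simp add: triangle[OF x y(1)] blinfun.diff_right)
      also have "norm \<dots> \<le> e * norm (y - x)"
        using d(2) seg near
        by (intro norm_line_integral_le continuous_on_diff contseg x y continuous_on_const)
           (force simp: dist_norm less_imp_le)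
      finally show ?thesis .
    qed
    with d(1) show "\<exists>d>0. \<forall>y\<in>S. norm (y - x) < d \<longrightarrow>
        norm (line_integral \<omega> a y - line_integral \<omega> a x - blinfun_apply (\<omega> x) (y - x)) \<le> e * norm (y - x)"
      by blast
  qed
  then show thesis by (rule that)
qed

section \<open>Symmetry of the second derivative\<close>

text \<open>The second difference of \<open>f\<close> along \<open>t h\<close> and \<open>t k\<close> is symmetric in \<open>h\<close> and \<open>k\<close>. By the mean
  value inequality, applied to \<open>x \<mapsto> f(u + t h + x) - f(u + x)\<close> on the segment from \<open>0\<close> to \<open>t k\<close>, it equals
  \<open>t\<^sup>2 D(h)(k) + o(t\<^sup>2)\<close>.\<close>

theorem second_derivative_symmetric:
  fixes f :: "'a::real_normed_vector \<Rightarrow> 'b::real_normed_vector" and G :: "'a \<Rightarrow> 'a \<Rightarrow>\<^sub>L 'b"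
  assumes S: "open S" "u \<in> S"
    and f: "\<And>x. x \<in> S \<Longrightarrow> (f has_derivative blinfun_apply (G x)) (at x)"
    and G: "(G has_derivative D) (at u)"
  shows "blinfun_apply (D h) k = blinfun_apply (D k) h"
proof -
  interpret D: bounded_linear D using G by (rule has_derivative_bounded_linear)
  define \<Delta> where "\<Delta> t = f (u + t *\<^sub>R h + t *\<^sub>R k) - f (u + t *\<^sub>R h) - f (u + t *\<^sub>R k) + f u" for t :: real
  define M where "M = norm h + norm k"
  have M: "M \<ge> 0" "norm h \<le> M" "norm k \<le> M" by (auto simp: M_def)
  have "norm (blinfun_apply (D h) k - blinfun_apply (D k) h) \<le> 4 * e * M\<^sup>2" if e: "e > 0" for e
  proof -
    obtain d where d: "d > 0" "\<And>x. norm (x - u) < d \<Longrightarrow> norm (G x - G u - D (x - u)) \<le> e * norm (x - u)"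
      using G e unfolding has_derivative_at_alt by blast
    obtain d' where d': "d' > 0" "ball u d' \<subseteq> S" using S openE by blast
    define t where "t = min d d' / (M + 1)"
    have t: "t > 0" using d d' M by (simp add: t_def)
    have "0 < min d d'" using d(1) d'(1) by simp
    then have "t * M < min d d'"
      unfolding t_def using M(1) by (simp only: pos_divide_less_eq times_divide_eq_left) (simp add: distrib_left)
    then have tM: "t * M < d" "t * M < d'" by auto
    have bound: "norm (f (u + t *\<^sub>R v + t *\<^sub>R w) - f (u + t *\<^sub>R v) - f (u + t *\<^sub>R w) + f u
        - t\<^sup>2 *\<^sub>R blinfun_apply (D v) w) \<le> 2 * e * t\<^sup>2 * M\<^sup>2"
      if vw: "norm v + norm w = M" for v w
    proof -
      define \<phi> where "\<phi> x = f (u + t *\<^sub>R v + x) - f (u + x) - t *\<^sub>R blinfun_apply (D v) x" for x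
      define \<phi>' where "\<phi>' x = G (u + t *\<^sub>R v + x) - G (u + x) - t *\<^sub>R D v" for x
      have small: "norm x \<le> t * norm w" if "x \<in> closed_segment 0 (t *\<^sub>R w)" for x
        using segment_bound1[OF that] t by simp
      have vx: "norm (t *\<^sub>R v + x) \<le> t * M" and x: "norm x \<le> t * M"
        if "x \<in> closed_segment 0 (t *\<^sub>R w)" for x
      proof -
        show "norm (t *\<^sub>R v + x) \<le> t * M"
          using small[OF that] norm_triangle_ineq[of "t *\<^sub>R v" x] t
          by (simp add: vw[symmetric] distrib_left)
        show "norm x \<le> t * M"
          using small[OF that] t mult_left_mono[of "norm w" M t] vw norm_ge_zero[of v] by linarith
      qed
      have in_S: "y \<in> S" if "norm (y - u) \<le> t * M" for y
        using d'(2) that tM by (auto simp: dist_norm norm_minus_commute subset_iff)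
      have "norm (\<phi> (t *\<^sub>R w) - \<phi> 0) \<le> (2 * e * t * M) * norm (t *\<^sub>R w - 0)"
      proof (rule differentiable_bound[where f' = "\<lambda>x. blinfun_apply (\<phi>' x)"])
        show "convex (closed_segment 0 (t *\<^sub>R w))" by simp
        show "0 \<in> closed_segment 0 (t *\<^sub>R w)" "t *\<^sub>R w \<in> closed_segment 0 (t *\<^sub>R w)" by auto
        fix y assume y: "y \<in> closed_segment 0 (t *\<^sub>R w)"
        have sh: "(f has_derivative blinfun_apply (G (c + y))) (at (c + y)) \<Longrightarrow>
            ((\<lambda>x. f (c + x)) has_derivative blinfun_apply (G (c + y))) (at y within T)" for c T
          by (rule has_derivative_at_withinI, rule has_derivative_compose[of "\<lambda>x. c + x" "\<lambda>h. h" y UNIV f, simplified])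
            (auto intro!: derivative_eq_intros)
        have 1: "u + t *\<^sub>R v + y \<in> S" "u + y \<in> S"
          using vx[OF y] x[OF y] by (auto intro!: in_S simp: algebra_simps)
        have "(\<phi> has_derivative (\<lambda>h. blinfun_apply (G (u + t *\<^sub>R v + y)) h - blinfun_apply (G (u + y)) h
            - t *\<^sub>R blinfun_apply (D v) h)) (at y within closed_segment 0 (t *\<^sub>R w))"
          unfolding \<phi>_def
          by (intro has_derivative_diff sh f 1 has_derivative_scaleR_right
              bounded_linear_imp_has_derivative blinfun.bounded_linear_right)
        then show "(\<phi> has_derivative blinfun_apply (\<phi>' y)) (at y within closed_segment 0 (t *\<^sub>R w))"
          by (simp add: \<phi>'_def blinfun.diff_left[abs_def] blinfun.scaleR_left[abs_def])
        have "\<phi>' y = (G (u + t *\<^sub>R v + y) - G u - D (t *\<^sub>R v + y)) - (G (u + y) - G u - D y)"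
          by (simp add: \<phi>'_def D.add D.scaleR)
        also have "norm \<dots> \<le> e * norm (t *\<^sub>R v + y) + e * norm y"
        proof (rule order_trans[OF norm_triangle_ineq4 add_mono])
          show "norm (G (u + t *\<^sub>R v + y) - G u - D (t *\<^sub>R v + y)) \<le> e * norm (t *\<^sub>R v + y)"
            using d(2)[of "u + t *\<^sub>R v + y"] vx[OF y] tM by (simp add: add.assoc)
          show "norm (G (u + y) - G u - D y) \<le> e * norm y"
            using d(2)[of "u + y"] x[OF y] tM by simp
        qed
        also have "\<dots> \<le> e * (t * M) + e * (t * M)"
          using vx[OF y] x[OF y] e by (intro add_mono mult_left_mono) auto
        finally show "onorm (blinfun_apply (\<phi>' y)) \<le> 2 * e * t * M"
          by (simp add: norm_blinfun.rep_eq mult_ac)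
      qed
      also have "\<dots> \<le> (2 * e * t * M) * (t * M)"
        using t e M vw by (intro mult_left_mono) (auto simp: mult_left_mono)
      finally show ?thesis
        by (simp add: \<phi>_def power2_eq_square blinfun.scaleR_right algebra_simps)
    qed
    have "t\<^sup>2 * norm (blinfun_apply (D h) k - blinfun_apply (D k) h)
      = norm ((\<Delta> t - t\<^sup>2 *\<^sub>R blinfun_apply (D k) h) - (\<Delta> t - t\<^sup>2 *\<^sub>R blinfun_apply (D h) k))"
      by (simp flip: scaleR_diff_right)
    also have "\<dots> \<le> 2 * e * t\<^sup>2 * M\<^sup>2 + 2 * e * t\<^sup>2 * M\<^sup>2"
      using bound[of h k] bound[of k h]
      by (intro order_trans[OF norm_triangle_ineq4 add_mono]) (simp_all add: \<Delta>_def M_def algebra_simps)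
    also have "\<dots> = t\<^sup>2 * (4 * e * M\<^sup>2)" by simp
    finally show ?thesis using t by (subst (asm) mult_le_cancel_left_pos) auto
  qed
  note le = this
  have "norm (blinfun_apply (D h) k - blinfun_apply (D k) h) \<le> 0"
  proof (rule field_le_epsilon)
    fix e :: real assume e: "e > 0"
    have "4 * (e / (4 * q)) * m = e * (m / q)" for m q :: real by simp
    then have "4 * (e / (4 * (M\<^sup>2 + 1))) * M\<^sup>2 = e * (M\<^sup>2 / (M\<^sup>2 + 1))" .
    also have "\<dots> \<le> e * 1"
      using e pos_divide_le_eq[of "M\<^sup>2 + 1" "M\<^sup>2" 1]
      by (intro mult_left_mono) (simp_all add: add_nonneg_pos)
    finally show "norm (blinfun_apply (D h) k - blinfun_apply (D k) h) \<le> 0 + e"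
      using le[of "e / (4 * (M\<^sup>2 + 1))"] e by (simp add: add_nonneg_pos)
  qed
  then show ?thesis by simp
qed

section \<open>Cauchy's formula for the derivative of a vector-valued function\<close>

lemma bounded_bilinear_scaleC:
  "bounded_bilinear ((*\<^sub>C) :: complex \<Rightarrow> 'a \<Rightarrow> 'a::complex_normed_vector)"
proof
  show "(r *\<^sub>R a) *\<^sub>C b = r *\<^sub>R a *\<^sub>C b" for r a and b :: 'a
    by (simp add: scaleC_scaleC flip: scaleC_of_real scaleR_conv_of_real)
  show "\<exists>K. \<forall>a (b::'a). norm (a *\<^sub>C b) \<le> norm a * norm b * K"
    by (rule exI[of _ 1]) (simp add: norm_scaleC)
qed (simp_all add: scaleC_add_left scaleC_add_right scaleC_scaleR_commute)

interpretation scaleC: bounded_bilinear "(*\<^sub>C) :: complex \<Rightarrow> 'a \<Rightarrow> 'a::complex_normed_vector"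
  by (rule bounded_bilinear_scaleC)

lemma scaleC_commute: "a *\<^sub>C b *\<^sub>C (x::'a::complex_normed_vector) = b *\<^sub>C a *\<^sub>C x"
  by (simp add: scaleC_scaleC mult.commute)

text \<open>The form \<open>w \<mapsto> w h(z)\<close> of contour integration, with the value \<open>y = h(z)\<close> as the argument.\<close>

definition complex_line :: "'b::complex_normed_vector \<Rightarrow> complex \<Rightarrow>\<^sub>L 'b" where
  "complex_line y = Blinfun (\<lambda>w. w *\<^sub>C y)"

lemma complex_line_apply [simp]: "blinfun_apply (complex_line y) w = w *\<^sub>C y"
  by (simp add: complex_line_def bounded_linear_Blinfun_apply scaleC.bounded_linear_left)

lemma bounded_linear_complex_line: "bounded_linear complex_line"
  by (rule bounded_linear_intro[where K = 1])
    (auto intro!: blinfun_eqI norm_blinfun_bound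
      simp: blinfun.add_left blinfun.scaleR_left scaleC.add_right scaleC.scaleR_right norm_scaleC mult.commute)

text \<open>Complex differentiability of \<open>h\<close> says exactly that the form \<open>w \<mapsto> w h(z)\<close> has the derivative
  \<open>(v, w) \<mapsto> v w h'(z)\<close>, which is symmetric.\<close>

lemma complex_differentiable_imp_primitive:
  fixes h :: "complex \<Rightarrow> 'b::complex_banach"
  assumes S: "convex S"
    and h: "\<And>z. z \<in> S \<Longrightarrow> (h has_derivative (\<lambda>w. w *\<^sub>C h' z)) (at z within S)"
  obtains H where "\<And>z. z \<in> S \<Longrightarrow> (H has_derivative (\<lambda>w. w *\<^sub>C h z)) (at z within S)"
proof -
  have "((\<lambda>z. complex_line (h z)) has_derivative (\<lambda>w. complex_line (w *\<^sub>C h' z))) (at z within S)"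
    if "z \<in> S" for z
    by (rule bounded_linear.has_derivative[OF bounded_linear_complex_line h[OF that]])
  then obtain H where "\<And>z. z \<in> S \<Longrightarrow> (H has_derivative blinfun_apply (complex_line (h z))) (at z within S)"
    using symmetric_derivative_imp_primitive[OF S, of "\<lambda>z. complex_line (h z)" "\<lambda>z w. complex_line (w *\<^sub>C h' z)"]
    by (auto simp: scaleC_commute)
  then show thesis by (intro that) (simp add: complex_line_def bounded_linear_Blinfun_apply scaleC.bounded_linear_left)
qed

lemma has_integral_exp_2pi: "((\<lambda>\<theta>. exp (- (\<i> * complex_of_real \<theta>))) has_integral 0) {0..2 * pi}"
proof -
  have "((\<lambda>\<theta>. \<i> * exp (- (\<i> * complex_of_real \<theta>))) has_vector_derivative exp (- (\<i> * complex_of_real \<theta>)))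
      (at \<theta> within {0..2 * pi})" for \<theta>
  proof -
    have "((\<lambda>z. \<i> * exp (- (\<i> * z))) has_field_derivative exp (- (\<i> * complex_of_real \<theta>)))
        (at (complex_of_real \<theta>))"
      by (rule derivative_eq_intros refl)+ (simp add: mult_ac)
    then show ?thesis by (rule has_vector_derivative_real_field)
  qed
  then have "((\<lambda>\<theta>. exp (- (\<i> * complex_of_real \<theta>))) has_integral
      (\<i> * exp (- (\<i> * complex_of_real (2 * pi))) - \<i> * exp (- (\<i> * complex_of_real 0)))) {0..2 * pi}"
    by (intro fundamental_theorem_of_calculus) auto
  moreover have "exp (- (\<i> * complex_of_real (2 * pi))) = 1"
    unfolding exp_minus cis_conv_exp[symmetric] by simp
  ultimately show ?thesis by simp
qed

text \<open>The substitution by \<open>e\<^sup>z\<close> replaces the punctured disc by a half plane, where primitives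
  exist. Along a vertical segment of length \<open>2 \<pi>\<close> the increment of a primitive of \<open>e\<^sup>-\<^sup>z h(e\<^sup>z)\<close>
  is the integral in question up to a factor, which shows that the integral divided by the radius
  does not depend on the radius. Differentiability of \<open>h\<close> at \<open>0\<close> gives the value of this constant.\<close>

theorem Cauchy_derivative_formula:
  fixes h :: "complex \<Rightarrow> 'b::complex_banach"
  assumes h: "\<And>z. z \<in> ball 0 R \<Longrightarrow> (h has_derivative (\<lambda>w. w *\<^sub>C h' z)) (at z)"
    and r: "0 < r" "r < R"
  shows "((\<lambda>\<theta>. exp (- (\<i> * complex_of_real \<theta>)) *\<^sub>C h (complex_of_real r * exp (\<i> * complex_of_real \<theta>)))
    has_integral (2 * pi * r) *\<^sub>R h' 0) {0..2 * pi}"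
proof -
  define S where "S = {z. Re z < ln R}"
  have R: "R > 0" using r by simp
  have S: "convex S" "open S"
    unfolding S_def by (rule convex_halfspace_Re_lt open_halfspace_Re_lt)+
  have exp_S: "exp z \<in> ball 0 R" if "z \<in> S" for z
    using that R by (simp add: S_def) (metis exp_less_mono exp_ln)
  define k where "k z = exp (- z) *\<^sub>C h (exp z)" for z
  have k: "(k has_derivative (\<lambda>w. w *\<^sub>C (h' (exp z) - exp (- z) *\<^sub>C h (exp z)))) (at z within S)"
    if z: "z \<in> S" for z
  proof -
    have 1: "((\<lambda>z. exp (- z)) has_derivative (\<lambda>w. - exp (- z) * w)) (at z within S)"
      by (rule has_field_derivative_imp_has_derivative) (auto intro!: derivative_eq_intros)
    have 2: "((\<lambda>z. h (exp z)) has_derivative (\<lambda>w. (exp z * w) *\<^sub>C h' (exp z))) (at z within S)"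
      by (rule has_derivative_compose[where f = exp and g = h, OF _ h[OF exp_S[OF z]]])
        (rule has_field_derivative_imp_has_derivative, auto intro!: derivative_eq_intros)
    have "exp (- z) *\<^sub>C (exp z * w) *\<^sub>C h' (exp z) + (- exp (- z) * w) *\<^sub>C h (exp z)
        = w *\<^sub>C (h' (exp z) - exp (- z) *\<^sub>C h (exp z))" for w
    proof -
      have "exp (- z) * exp z = 1" by (simp add: exp_minus)
      then have "exp (- z) * (exp z * w) = w" by (simp flip: mult.assoc)
      then have 1: "exp (- z) *\<^sub>C (exp z * w) *\<^sub>C y = w *\<^sub>C y" for y :: 'b
        by (simp only: scaleC_scaleC)
      have 2: "(- exp (- z) * w) *\<^sub>C y = - (w *\<^sub>C exp (- z) *\<^sub>C y)" for y :: 'b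
        by (simp add: scaleC_scaleC scaleC.minus_left mult.commute)
      show ?thesis unfolding 1 2 by (simp add: scaleC.diff_right)
    qed
    then show ?thesis
      using scaleC.FDERIV[OF 1 2] unfolding k_def by simp
  qed
  obtain P where P: "\<And>z. z \<in> S \<Longrightarrow> (P has_derivative (\<lambda>w. w *\<^sub>C k z)) (at z within S)"
    using complex_differentiable_imp_primitive[OF S(1) k] by blast
  have P_at: "(P has_derivative (\<lambda>w. w *\<^sub>C k z)) (at z)" if "z \<in> S" for z
    using P[OF that] at_within_open[OF that S(2)] by simp
  have period: "k (z + 2 * pi * \<i>) = k z" for z
    by (simp add: k_def exp_add exp_diff minus_add exp_minus)
  have "((\<lambda>z. P (z + 2 * pi * \<i>) - P z) has_derivative (\<lambda>_. 0)) (at z within S)" if z: "z \<in> S" for z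
  proof -
    have in_S: "z + 2 * pi * \<i> \<in> S" using z by (simp add: S_def)
    have shift: "((\<lambda>z. z + 2 * pi * \<i>) has_derivative (\<lambda>w. w)) (at z within S)"
      by (auto intro!: derivative_eq_intros)
    have "((\<lambda>z. P (z + 2 * pi * \<i>)) has_derivative (\<lambda>w. w *\<^sub>C k z)) (at z within S)"
      using has_derivative_compose[where g = P, OF shift P_at[OF in_S]] unfolding period .
    from has_derivative_diff[OF this P[OF z]] show ?thesis by simp
  qed
  then have "\<exists>c. \<forall>z\<in>S. P (z + 2 * pi * \<i>) - P z = c"
    by (rule has_derivative_zero_constant[OF S(1)])
  then obtain c where c: "\<And>z. z \<in> S \<Longrightarrow> P (z + 2 * pi * \<i>) - P z = c" by blast
  \<comment> \<open>\<open>c\<close> is \<open>\<i>\<close> times the integral over the circle of radius \<open>s\<close>, divided by \<open>s\<close>.\<close>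
  define c' where "c' = - \<i> *\<^sub>C c"
  let ?e = "\<lambda>\<theta>::real. exp (- (\<i> * complex_of_real \<theta>))"
  have circle: "((\<lambda>\<theta>. ?e \<theta> *\<^sub>C h (complex_of_real s * exp (\<i> * complex_of_real \<theta>)))
      has_integral s *\<^sub>R c') {0..2 * pi}" if s: "0 < s" "s < R" for s
  proof -
    define x where "x = ln s"
    have ex: "exp (complex_of_real x) = s" using s by (simp add: x_def exp_of_real)
    have in_S: "complex_of_real x + \<i> * complex_of_real \<theta> \<in> S" for \<theta>
      using s by (simp add: S_def x_def)
    have "((\<lambda>\<theta>. P (complex_of_real x + \<i> * complex_of_real \<theta>)) has_vector_derivative
        \<i> *\<^sub>C k (complex_of_real x + \<i> * complex_of_real \<theta>)) (at \<theta> within {0..2 * pi})" for \<theta>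
    proof -
      have "((\<lambda>\<theta>. complex_of_real x + \<i> * complex_of_real \<theta>) has_derivative (\<lambda>t. \<i> * complex_of_real t))
          (at \<theta> within {0..2 * pi})"
        by (auto intro!: derivative_eq_intros)
      from has_derivative_compose[where g = P, OF this P_at[OF in_S]]
      show ?thesis
        by (simp add: has_vector_derivative_def mult.commute[of \<i>] flip: scaleC_of_real scaleC_scaleC)
    qed
    then have "((\<lambda>\<theta>. \<i> *\<^sub>C k (complex_of_real x + \<i> * complex_of_real \<theta>)) has_integral
        (P (complex_of_real x + \<i> * complex_of_real (2 * pi)) - P (complex_of_real x + \<i> * complex_of_real 0))) {0..2 * pi}"
      by (intro fundamental_theorem_of_calculus) auto
    also have "P (complex_of_real x + \<i> * complex_of_real (2 * pi)) - P (complex_of_real x + \<i> * complex_of_real 0) = c"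
      using c[of "complex_of_real x"] in_S[of 0] by (simp add: mult_ac)
    finally have "((\<lambda>\<theta>. (- \<i> * s) *\<^sub>C \<i> *\<^sub>C k (complex_of_real x + \<i> * complex_of_real \<theta>)) has_integral
        (- \<i> * s) *\<^sub>C c) {0..2 * pi}"
      using has_integral_linear[OF _ scaleC.bounded_linear_right[of "- \<i> * s"]] by (simp add: o_def)
    moreover have "(- \<i> * s) *\<^sub>C \<i> *\<^sub>C k (complex_of_real x + \<i> * complex_of_real \<theta>)
        = ?e \<theta> *\<^sub>C h (complex_of_real s * exp (\<i> * complex_of_real \<theta>))" for \<theta>
    proof -
      have "- \<i> * complex_of_real s * \<i> * exp (- (complex_of_real x + \<i> * complex_of_real \<theta>)) = ?e \<theta>"
        using s by (simp add: exp_add exp_diff exp_minus ex field_simps)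
      then show ?thesis by (simp add: k_def scaleC_scaleC exp_add ex mult.assoc)
    qed
    moreover have "(- \<i> * s) *\<^sub>C c = s *\<^sub>R c'"
      by (simp add: c'_def scaleC_scaleC mult.commute flip: scaleC_of_real)
    ultimately show ?thesis by simp
  qed
  have "norm (c' - (2 * pi) *\<^sub>R h' 0) \<le> 0"
  proof (rule field_le_epsilon)
    fix e :: real assume e: "e > 0"
    have "(h has_derivative (\<lambda>w. w *\<^sub>C h' 0)) (at 0)" using h R by simp
    then obtain d where d: "d > 0" "\<And>z. norm z < d \<Longrightarrow> norm (h z - h 0 - z *\<^sub>C h' 0) \<le> e / (2 * pi) * norm z"
      using e unfolding has_derivative_at_alt by (metis diff_zero divide_pos_pos pi_gt_zero zero_less_mult_iff zero_less_numeral)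
    define s where "s = min d R / 2"
    have s: "0 < s" "s < R" "s < d" using d R by (auto simp: s_def)
    have one: "?e \<theta> * (complex_of_real s * exp (\<i> * complex_of_real \<theta>)) = s" for \<theta>
      by (simp add: exp_minus)
    \<comment> \<open>The constant term of \<open>h\<close> integrates to \<open>0\<close> and the linear term to \<open>2 \<pi> s h'(0)\<close>.\<close>
    have "((\<lambda>\<theta>. ?e \<theta> *\<^sub>C h (complex_of_real s * exp (\<i> * complex_of_real \<theta>)) - ?e \<theta> *\<^sub>C h 0 - s *\<^sub>R h' 0)
        has_integral s *\<^sub>R c' - 0 *\<^sub>C h 0 - measure lborel {0..2 * pi} *\<^sub>R s *\<^sub>R h' 0) {0..2 * pi}"
      by (intro has_integral_diff circle s has_integral_const_real
          has_integral_linear[OF has_integral_exp_2pi scaleC.bounded_linear_left, unfolded o_def])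
    moreover have "?e \<theta> *\<^sub>C h (complex_of_real s * exp (\<i> * complex_of_real \<theta>)) - ?e \<theta> *\<^sub>C h 0 - s *\<^sub>R h' 0
      = ?e \<theta> *\<^sub>C (h (complex_of_real s * exp (\<i> * complex_of_real \<theta>)) - h 0
          - (complex_of_real s * exp (\<i> * complex_of_real \<theta>)) *\<^sub>C h' 0)" for \<theta>
      by (simp add: scaleC.diff_right scaleC_scaleC one scaleC_of_real)
    ultimately have I: "((\<lambda>\<theta>. ?e \<theta> *\<^sub>C (h (complex_of_real s * exp (\<i> * complex_of_real \<theta>)) - h 0
          - (complex_of_real s * exp (\<i> * complex_of_real \<theta>)) *\<^sub>C h' 0))
        has_integral s *\<^sub>R (c' - (2 * pi) *\<^sub>R h' 0)) {0..2 * pi}"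
      by (simp add: scaleR_diff_right mult.commute scaleC.zero_left)
    have "norm (s *\<^sub>R (c' - (2 * pi) *\<^sub>R h' 0)) \<le> (e / (2 * pi) * s) * measure lborel {0..2 * pi}"
    proof (rule has_integral_bound_real[OF _ finite.emptyI I])
      show "0 \<le> e / (2 * pi) * s" using e s by simp
      show "norm (?e \<theta> *\<^sub>C (h (complex_of_real s * exp (\<i> * complex_of_real \<theta>)) - h 0
          - (complex_of_real s * exp (\<i> * complex_of_real \<theta>)) *\<^sub>C h' 0)) \<le> e / (2 * pi) * s" for \<theta>
        using d(2)[of "complex_of_real s * exp (\<i> * complex_of_real \<theta>)"] s
        by (simp add: norm_scaleC norm_mult exp_minus norm_inverse)
    qed
    then have "s * norm (c' - (2 * pi) *\<^sub>R h' 0) \<le> s * e" using s by (simp add: mult.commute)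
    then show "norm (c' - (2 * pi) *\<^sub>R h' 0) \<le> 0 + e" using s by simp
  qed
  then have "c' = (2 * pi) *\<^sub>R h' 0" by simp
  then show ?thesis using circle[OF r] by (simp add: mult.commute)
qed

section \<open>Continuous complex-linear maps\<close>

lemma cblinfun_apply_eq_blinfun: "blinfun_apply (blinfun_of_cblinfun g) = cblinfun_apply g"
  by (simp add: cblinfun_apply.rep_eq)

lemma bounded_linear_cblinfun_apply: "bounded_linear (cblinfun_apply g)"
  unfolding cblinfun_apply_eq_blinfun[symmetric] by (rule blinfun.bounded_linear_right)

lemma cblinfun_apply_scaleC: "cblinfun_apply g (c *\<^sub>C x) = c *\<^sub>C cblinfun_apply g x"
  using blinfun_of_cblinfun[of g] by (simp add: cblinfun_apply.rep_eq)

lemma minus_cblinfun_apply: "cblinfun_apply (f - g) x = cblinfun_apply f x - cblinfun_apply g x"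
  by transfer (simp add: blinfun.diff_left)

lemma norm_cblinfun_apply_le: "norm (cblinfun_apply g x) \<le> norm g * norm x"
  by transfer (rule norm_blinfun)

lemma norm_cblinfun_bound:
  "0 \<le> b \<Longrightarrow> (\<And>x. norm (cblinfun_apply g x) \<le> b * norm x) \<Longrightarrow> norm g \<le> b"
  by transfer (rule norm_blinfun_bound)

lemma bounded_linear_blinfun_of_cblinfun: "bounded_linear blinfun_of_cblinfun"
  by (rule bounded_linear_intro[where K = 1])
    (simp_all add: plus_cblinfun.rep_eq scaleR_cblinfun.rep_eq norm_cblinfun.rep_eq)

lemma bounded_bilinear_cblinfun_apply: "bounded_bilinear cblinfun_apply"
proof -
  have "bounded_bilinear (\<lambda>g x. blinfun_apply (blinfun_of_cblinfun g) x)"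
    by (rule bounded_bilinear.comp1[OF bounded_bilinear_blinfun_apply bounded_linear_blinfun_of_cblinfun])
  then show ?thesis by (simp add: cblinfun_apply_eq_blinfun)
qed

interpretation cblinfun: bounded_bilinear cblinfun_apply
  by (rule bounded_bilinear_cblinfun_apply)

lemma cblinfun_exists:
  assumes "bounded_linear F" and "\<And>c x. F (c *\<^sub>C x) = c *\<^sub>C F x"
  obtains D where "cblinfun_apply D = F"
proof
  show "cblinfun_apply (Abs_cblinfun (Blinfun F)) = F"
    using assms by (simp add: cblinfun_apply.rep_eq Abs_cblinfun_inverse bounded_linear_Blinfun_apply)
qed

section \<open>The derivative of a Lipschitz holomorphic map is holomorphic\<close>

lemma norm_derivative_le_lipschitz:
  fixes f :: "'a::complex_normed_vector \<Rightarrow> 'b::complex_normed_vector"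
  assumes U: "open U" "x \<in> U" and lip: "L-lipschitz_on U f"
    and f: "(f has_derivative cblinfun_apply D) (at x)"
  shows "norm D \<le> L"
proof (rule field_le_epsilon)
  fix e :: real assume e: "e > 0"
  obtain d where d: "d > 0"
    "\<And>y. norm (y - x) < d \<Longrightarrow> norm (f y - f x - cblinfun_apply D (y - x)) \<le> e * norm (y - x)"
    using f e unfolding has_derivative_at_alt by blast
  obtain d' where d': "d' > 0" "ball x d' \<subseteq> U" using U openE by blast
  show "norm D \<le> L + e"
  proof (rule norm_cblinfun_bound)
    show "0 \<le> L + e" using lipschitz_on_nonneg[OF lip] e by simp
    fix y :: 'a
    define t where "t = min d d' / (norm y + 1)"
    have m: "0 < min d d'" using d(1) d'(1) by simp
    then have t: "0 < t" by (simp add: t_def add_nonneg_pos)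
    have "t * norm y < min d d'"
      using m unfolding t_def
      by (simp only: pos_divide_less_eq times_divide_eq_left norm_ge_zero add_nonneg_pos zero_less_one)
        (simp add: distrib_left)
    then have ty: "norm (t *\<^sub>R y) < d" "norm (t *\<^sub>R y) < d'" using t by auto
    have "norm (f (x + t *\<^sub>R y) - f x - cblinfun_apply D (t *\<^sub>R y)) \<le> e * norm (t *\<^sub>R y)"
      using d(2)[of "x + t *\<^sub>R y"] ty by simp
    moreover have "norm (f (x + t *\<^sub>R y) - f x) \<le> L * norm (t *\<^sub>R y)"
      using lipschitz_on_normD[OF lip, of "x + t *\<^sub>R y" x] U d'(2) ty
      by (auto simp: dist_norm subset_iff)
    ultimately have "norm (cblinfun_apply D (t *\<^sub>R y)) \<le> (L + e) * norm (t *\<^sub>R y)"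
      using norm_triangle_ineq2[of "cblinfun_apply D (t *\<^sub>R y)" "f (x + t *\<^sub>R y) - f x"]
      by (simp only: norm_minus_commute[of "cblinfun_apply D (t *\<^sub>R y)"] distrib_right)
    then have "t * norm (cblinfun_apply D y) \<le> t * ((L + e) * norm y)"
      using t by (simp add: cblinfun.scaleR_right mult.left_commute)
    then show "norm (cblinfun_apply D y) \<le> (L + e) * norm y"
      using t by (subst (asm) mult_le_cancel_left_pos) auto
  qed
qed

lemma Cauchy_directional_derivative_formula:
  fixes f :: "'a::complex_normed_vector \<Rightarrow> 'b::complex_banach"
  assumes f: "\<And>x. x \<in> U \<Longrightarrow> (f has_derivative cblinfun_apply (G x)) (at x)"
    and disc: "\<And>z. cmod z < R \<Longrightarrow> v + z *\<^sub>C y \<in> U"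
    and r: "0 < r" "r < R"
  shows "((\<lambda>\<theta>. exp (- (\<i> * complex_of_real \<theta>)) *\<^sub>C
      f (v + (complex_of_real r * exp (\<i> * complex_of_real \<theta>)) *\<^sub>C y))
    has_integral (2 * pi * r) *\<^sub>R cblinfun_apply (G v) y) {0..2 * pi}"
proof -
  have "((\<lambda>z. f (v + z *\<^sub>C y)) has_derivative (\<lambda>w. w *\<^sub>C cblinfun_apply (G (v + z *\<^sub>C y)) y)) (at z)"
    if "z \<in> ball 0 R" for z
  proof -
    have "((\<lambda>z. v + z *\<^sub>C y) has_derivative (\<lambda>w. w *\<^sub>C y)) (at z)"
      using bounded_linear_imp_has_derivative[OF scaleC.bounded_linear_left[of y]]
      by (auto intro!: derivative_eq_intros)
    from has_derivative_compose[where g = f, OF this f] that disc show ?thesis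
      by (simp add: cblinfun_apply_scaleC)
  qed
  from Cauchy_derivative_formula[OF this r] show ?thesis by (simp add: scaleC.zero_left)
qed

lemma has_derivative_of_quadratic_remainder:
  fixes F :: "'a::real_normed_vector \<Rightarrow> 'b::real_normed_vector"
  assumes D: "bounded_linear D" and \<delta>: "\<delta> > 0"
    and rem: "\<And>w. norm w < \<delta> \<Longrightarrow> norm (F (u + w) - F u - D w) \<le> K * (norm w)\<^sup>2"
  shows "(F has_derivative D) (at u)"
  unfolding has_derivative_at_alt
proof (intro conjI allI impI D)
  fix e :: real assume e: "e > 0"
  let ?d = "min \<delta> (e / (\<bar>K\<bar> + 1))"
  have "norm (F y - F u - D (y - u)) \<le> e * norm (y - u)" if y: "norm (y - u) < ?d" for y
  proof -
    have "norm (F y - F u - D (y - u)) \<le> K * norm (y - u) * norm (y - u)"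
      using rem[of "y - u"] y by (simp add: power2_eq_square)
    also have "\<dots> \<le> e * norm (y - u)"
    proof (rule mult_right_mono)
      have "K * norm (y - u) \<le> (\<bar>K\<bar> + 1) * norm (y - u)"
        by (intro mult_right_mono) auto
      also have "\<dots> \<le> e" using y by (simp add: pos_less_divide_eq mult.commute)
      finally show "K * norm (y - u) \<le> e" .
    qed simp
    finally show ?thesis .
  qed
  moreover have "?d > 0" using \<delta> e by simp
  ultimately show "\<exists>d>0. \<forall>y. norm (y - u) < d \<longrightarrow> norm (F y - F u - D (y - u)) \<le> e * norm (y - u)"
    by blast
qed

text \<open>The directional Cauchy formula at \<open>v\<close> and at \<open>v'\<close>, on circles of radius \<open>\<rho>\<close>: subtracting
  compares \<open>f\<close> at points that differ by \<open>v - v'\<close>, so the Lipschitz constant of \<open>f\<close> reappears, divided by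
  the radius. The circles around points of \<open>ball u (2 \<rho>)\<close> stay inside \<open>ball u (3 \<rho>)\<close>.\<close>

lemma derivative_lipschitz_estimate:
  fixes f :: "'a::complex_normed_vector \<Rightarrow> 'b::complex_banach"
  assumes f: "\<And>x. x \<in> ball u (3 * \<rho>) \<Longrightarrow> (f has_derivative cblinfun_apply (G x)) (at x)"
    and lip: "L-lipschitz_on (ball u (3 * \<rho>)) f"
    and \<rho>: "\<rho> > 0"
    and vv': "v \<in> ball u (2 * \<rho>)" "v' \<in> ball u (2 * \<rho>)"
  shows "norm (G v - G v') \<le> L / \<rho> * norm (v - v')"
proof (rule norm_cblinfun_bound)
  have L: "0 \<le> L" using lip by (rule lipschitz_on_nonneg)
  then show "0 \<le> L / \<rho> * norm (v - v')" using \<rho> by simp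
  fix y
  show "norm (cblinfun_apply (G v - G v') y) \<le> L / \<rho> * norm (v - v') * norm y"
  proof (cases "y = 0")
    case True
    then show ?thesis by (simp add: cblinfun.zero_right)
  next
    case False
    \<comment> \<open>The circle \<open>v + r e\<^sup>i\<^sup>\<theta> y\<close> then has radius \<open>\<rho>\<close> whatever \<open>y\<close> is.\<close>
    define r where "r = \<rho> / norm y"
    have r: "0 < r" using \<rho> False by (simp add: r_def)
    let ?z = "\<lambda>\<theta>. complex_of_real r * exp (\<i> * complex_of_real \<theta>)"
    let ?e = "\<lambda>\<theta>. exp (- (\<i> * complex_of_real \<theta>))"
    have in_ball: "x + z *\<^sub>C y \<in> ball u (3 * \<rho>)"
      if "x \<in> ball u (2 * \<rho>)" "cmod z < (3 * \<rho> - dist u x) / norm y" for x z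
      using that False norm_triangle_ineq[of "x - u" "z *\<^sub>C y"]
      by (simp add: dist_norm norm_minus_commute norm_scaleC pos_less_divide_eq algebra_simps)
    have I: "((\<lambda>\<theta>. ?e \<theta> *\<^sub>C f (x + ?z \<theta> *\<^sub>C y)) has_integral (2 * pi * r) *\<^sub>R cblinfun_apply (G x) y) {0..2 * pi}"
      if x: "x \<in> ball u (2 * \<rho>)" for x
      by (rule Cauchy_directional_derivative_formula[OF f in_ball[OF x] r])
        (use x False in \<open>auto simp: r_def intro!: divide_strict_right_mono\<close>)
    have circ: "x + ?z \<theta> *\<^sub>C y \<in> ball u (3 * \<rho>)" if x: "x \<in> ball u (2 * \<rho>)" for x \<theta>
    proof (rule in_ball[OF x])
      have "cmod (?z \<theta>) = r" using r by (simp add: norm_mult)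
      also have "\<dots> < (3 * \<rho> - dist u x) / norm y"
        unfolding r_def using x False by (intro divide_strict_right_mono) auto
      finally show "cmod (?z \<theta>) < (3 * \<rho> - dist u x) / norm y" .
    qed
    have "norm ((2 * pi * r) *\<^sub>R cblinfun_apply (G v) y - (2 * pi * r) *\<^sub>R cblinfun_apply (G v') y)
        \<le> (L * norm (v - v')) * measure lborel {0..2 * pi}"
    proof (rule has_integral_bound_real[OF _ finite.emptyI has_integral_diff[OF I[OF vv'(1)] I[OF vv'(2)]]])
      show "0 \<le> L * norm (v - v')" using L by simp
      fix \<theta>
      have "norm (f (v + ?z \<theta> *\<^sub>C y) - f (v' + ?z \<theta> *\<^sub>C y)) \<le> L * norm (v - v')"
        using lipschitz_on_normD[OF lip circ[OF vv'(1), of \<theta>] circ[OF vv'(2), of \<theta>]] by simp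
      then show "norm (?e \<theta> *\<^sub>C f (v + ?z \<theta> *\<^sub>C y) - ?e \<theta> *\<^sub>C f (v' + ?z \<theta> *\<^sub>C y)) \<le> L * norm (v - v')"
        by (simp add: norm_scaleC flip: scaleC.diff_right)
    qed
    then have "(2 * pi) * (r * norm (cblinfun_apply (G v - G v') y)) \<le> (2 * pi) * (L * norm (v - v'))"
      using r by (simp add: minus_cblinfun_apply mult.commute mult.left_commute flip: scaleR_diff_right)
    then have "r * norm (cblinfun_apply (G v - G v') y) \<le> L * norm (v - v')"
      by (subst (asm) mult_le_cancel_left_pos) auto
    then show ?thesis using \<rho> False by (simp add: r_def field_simps)
  qed
qed

lemma taylor_remainder_estimate:
  fixes f :: "'a::complex_normed_vector \<Rightarrow> 'b::complex_banach"
  assumes f: "\<And>x. x \<in> ball u (3 * \<rho>) \<Longrightarrow> (f has_derivative cblinfun_apply (G x)) (at x)"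
    and lip: "L-lipschitz_on (ball u (3 * \<rho>)) f"
    and \<rho>: "\<rho> > 0"
    and v: "v \<in> ball u (2 * \<rho>)" "v + w \<in> ball u (2 * \<rho>)"
  shows "norm (f (v + w) - f v - cblinfun_apply (G v) w) \<le> L / \<rho> * (norm w)\<^sup>2"
proof -
  let ?S = "closed_segment v (v + w)"
  have L: "0 \<le> L" using lip by (rule lipschitz_on_nonneg)
  have S: "?S \<subseteq> ball u (2 * \<rho>)" by (rule closed_segment_subset) (use v in auto)
  have "norm (f (v + w) - f v - cblinfun_apply (G v) (v + w - v)) \<le> norm (v + w - v) * (L / \<rho> * norm w)"
  proof (rule differentiable_bound_linearization)
    show "v + t *\<^sub>R (v + w - v) \<in> ?S" if "t \<in> {0..1}" for t
      using that by (rule in_closed_segment_param)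
    show "v \<in> ?S" by simp
    fix x assume x: "x \<in> ?S"
    have "x \<in> ball u (3 * \<rho>)" using S x \<rho> by (force simp: subset_iff)
    then show "(f has_derivative cblinfun_apply (G x)) (at x within ?S)"
      using f has_derivative_at_withinI by blast
    have "norm (G x - G v) \<le> L / \<rho> * norm (x - v)"
      by (rule derivative_lipschitz_estimate[OF f lip \<rho>]) (use S x v in auto)
    also have "\<dots> \<le> L / \<rho> * norm w"
      using segment_bound1[OF x] L \<rho> by (intro mult_left_mono) auto
    finally have "norm (G x - G v) \<le> L / \<rho> * norm w" .
    then have "norm (cblinfun_apply (G x - G v) y) \<le> L / \<rho> * norm w * norm y" for y
      using norm_cblinfun_apply_le[of "G x - G v" y] mult_right_mono[of _ _ "norm y"] order_trans norm_ge_zero by meson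
    then show "onorm (cblinfun_apply (G x) - cblinfun_apply (G v)) \<le> L / \<rho> * norm w"
      using L \<rho> by (intro onorm_bound) (simp_all add: minus_cblinfun_apply)
  qed
  then show ?thesis by (simp add: power2_eq_square mult_ac)
qed

text \<open>For fixed \<open>y\<close>, the derivative of \<open>x \<mapsto> G(x)(y)\<close> at \<open>u\<close> is found by differentiating the
  directional Cauchy formula under the integral sign: it is
  \<open>E w = 1 / (2 \<pi> r) \<integral> e\<^sup>-\<^sup>i\<^sup>\<theta> G(u + r e\<^sup>i\<^sup>\<theta> y)(w) d\<theta>\<close>. The error is a weighted average of Taylor remainders of
  \<open>f\<close> over the circle, so it is quadratic in \<open>w\<close>. That the constants are proportional to \<open>\<parallel>y\<parallel>\<close> makes the
  statement uniform over bounded sets of \<open>y\<close>.\<close>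

lemma pointwise_derivative_exists:
  fixes f :: "'a::complex_normed_vector \<Rightarrow> 'b::complex_banach"
  assumes f: "\<And>x. x \<in> ball u (3 * \<rho>) \<Longrightarrow> (f has_derivative cblinfun_apply (G x)) (at x)"
    and lip: "L-lipschitz_on (ball u (3 * \<rho>)) f"
    and \<rho>: "\<rho> > 0"
  obtains E :: "'a \<Rightarrow>\<^sub>C\<^sub>L 'b" where "norm E \<le> L / \<rho> * norm y"
    "\<And>w. norm w < \<rho> \<Longrightarrow>
      norm (cblinfun_apply (G (u + w)) y - cblinfun_apply (G u) y - cblinfun_apply E w)
        \<le> L / \<rho>\<^sup>2 * norm y * (norm w)\<^sup>2"
proof (cases "y = 0")
  case True
  show thesis
    by (rule that[of 0]) (simp_all add: True cblinfun.zero_right cblinfun.zero_left)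
next
  case False
  have L: "0 \<le> L" using lip by (rule lipschitz_on_nonneg)
  define r where "r = \<rho> / norm y"
  have r: "0 < r" using \<rho> False by (simp add: r_def)
  let ?z = "\<lambda>\<theta>. complex_of_real r * exp (\<i> * complex_of_real \<theta>)"
  let ?e = "\<lambda>\<theta>. exp (- (\<i> * complex_of_real \<theta>))"
  let ?I = "\<lambda>w. integral {0..2 * pi} (\<lambda>\<theta>. ?e \<theta> *\<^sub>C cblinfun_apply (G (u + ?z \<theta> *\<^sub>C y)) w)"
  have "cmod (?z \<theta>) = r" for \<theta>
    using r by (simp add: norm_mult)
  then have nz: "norm (?z \<theta> *\<^sub>C y) = \<rho>" for \<theta>
    using False by (simp only: norm_scaleC) (simp add: r_def)
  have circ: "u + ?z \<theta> *\<^sub>C y \<in> ball u (2 * \<rho>)" for \<theta>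
    using nz \<rho> by (simp add: dist_norm)
  have circ_w: "u + w + ?z \<theta> *\<^sub>C y \<in> ball u (2 * \<rho>)" if "norm w < \<rho>" for w \<theta>
    using nz[of \<theta>] that norm_triangle_ineq[of w "?z \<theta> *\<^sub>C y"]
    by (subst mem_ball, subst dist_commute) (simp add: dist_norm add.assoc)
  have norm_G: "norm (G x) \<le> L" if "x \<in> ball u (2 * \<rho>)" for x
    by (rule norm_derivative_le_lipschitz[OF _ _ lip f]) (use that \<rho> in auto)
  have cont_G: "continuous_on (ball u (2 * \<rho>)) G"
  proof (rule lipschitz_on_continuous_on[OF lipschitz_onI])
    show "dist (G x) (G y) \<le> L / \<rho> * dist x y" if "x \<in> ball u (2 * \<rho>)" "y \<in> ball u (2 * \<rho>)" for x y
      unfolding dist_norm by (rule derivative_lipschitz_estimate[OF f lip \<rho> that])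
    show "0 \<le> L / \<rho>" using L \<rho> by simp
  qed
  have cont_z: "continuous_on {0..2 * pi} (\<lambda>\<theta>. u + ?z \<theta> *\<^sub>C y)"
    by (intro continuous_intros scaleC.continuous_on)
  have int: "(\<lambda>\<theta>. ?e \<theta> *\<^sub>C cblinfun_apply (G (u + ?z \<theta> *\<^sub>C y)) w) integrable_on {0..2 * pi}" for w
    by (intro integrable_continuous_real continuous_intros scaleC.continuous_on cblinfun.continuous_on
        continuous_on_compose2[OF cont_G cont_z]) (use circ in blast)
  have norm_I: "norm (?I w) \<le> (L * norm w) * measure lborel {0..2 * pi}" for w
  proof (rule has_integral_bound_real[OF _ finite.emptyI integrable_integral[OF int]])
    show "0 \<le> L * norm w" using L by simp
    show "norm (?e \<theta> *\<^sub>C cblinfun_apply (G (u + ?z \<theta> *\<^sub>C y)) w) \<le> L * norm w" for \<theta>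
      using norm_cblinfun_apply_le[of "G (u + ?z \<theta> *\<^sub>C y)" w] mult_right_mono[OF norm_G[OF circ] norm_ge_zero[of w]]
      by (simp add: norm_scaleC order_trans)
  qed
  have rpi: "(1 / (2 * pi * r)) * ((L * q) * measure lborel {0..2 * pi}) = L / \<rho> * norm y * q" for q
    using False \<rho> by (simp add: r_def field_simps)
  have bound: "norm ((1 / (2 * pi * r)) *\<^sub>R ?I w) \<le> L / \<rho> * norm y * norm w" for w
    using mult_left_mono[OF norm_I[of w], of "1 / (2 * pi * r)"] r unfolding rpi by simp
  have "bounded_linear (\<lambda>w. (1 / (2 * pi * r)) *\<^sub>R ?I w)"
  proof (rule bounded_linear_intro[where K = "L / \<rho> * norm y"])
    show "(1 / (2 * pi * r)) *\<^sub>R ?I (w + w') = (1 / (2 * pi * r)) *\<^sub>R ?I w + (1 / (2 * pi * r)) *\<^sub>R ?I w'" for w w'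
      using integral_add[OF int int] by (simp add: cblinfun.add_right scaleC_add_right scaleR_add_right)
    show "(1 / (2 * pi * r)) *\<^sub>R ?I (c *\<^sub>R w) = c *\<^sub>R (1 / (2 * pi * r)) *\<^sub>R ?I w" for c w
      by (simp add: cblinfun.scaleR_right scaleC_scaleR_commute)
    show "norm ((1 / (2 * pi * r)) *\<^sub>R ?I w) \<le> norm w * (L / \<rho> * norm y)" for w
      using bound[of w] by (simp add: mult.commute)
  qed
  moreover have "(1 / (2 * pi * r)) *\<^sub>R ?I (c *\<^sub>C w) = c *\<^sub>C (1 / (2 * pi * r)) *\<^sub>R ?I w" for c w
    using integral_linear[OF int scaleC.bounded_linear_right[of c]]
    by (simp add: o_def cblinfun_apply_scaleC scaleC_commute[of c] scaleC_scaleR_commute)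
  ultimately obtain E where E: "cblinfun_apply E = (\<lambda>w. (1 / (2 * pi * r)) *\<^sub>R ?I w)"
    using cblinfun_exists by blast
  show thesis
  proof (rule that)
    show "norm E \<le> L / \<rho> * norm y"
      using bound L \<rho> by (intro norm_cblinfun_bound) (simp_all add: E)
    fix w :: 'a assume w: "norm w < \<rho>"
    have I: "((\<lambda>\<theta>. ?e \<theta> *\<^sub>C f (x + ?z \<theta> *\<^sub>C y)) has_integral (2 * pi * r) *\<^sub>R cblinfun_apply (G x) y) {0..2 * pi}"
      if x: "x \<in> ball u \<rho>" for x
    proof (rule Cauchy_directional_derivative_formula[OF f _ r])
      show "x + z *\<^sub>C y \<in> ball u (3 * \<rho>)" if "cmod z < 2 * r" for z
      proof -
        have "norm (z *\<^sub>C y) < 2 * \<rho>" using that False by (simp add: norm_scaleC r_def field_simps)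
        then show ?thesis using x norm_triangle_ineq[of "x - u" "z *\<^sub>C y"]
          by (simp add: dist_norm norm_minus_commute algebra_simps)
      qed
    qed (use r in auto)
    have "norm ((2 * pi * r) *\<^sub>R cblinfun_apply (G (u + w)) y - (2 * pi * r) *\<^sub>R cblinfun_apply (G u) y - ?I w)
        \<le> (L / \<rho> * (norm w)\<^sup>2) * measure lborel {0..2 * pi}"
    proof (rule has_integral_bound_real[OF _ finite.emptyI
          has_integral_diff[OF has_integral_diff[OF I I] integrable_integral[OF int]]])
      show "u + w \<in> ball u \<rho>" "u \<in> ball u \<rho>" using w \<rho> by (auto simp: dist_norm)
      show "0 \<le> L / \<rho> * (norm w)\<^sup>2" using L \<rho> by simp
      fix \<theta>
      have "norm (f (u + ?z \<theta> *\<^sub>C y + w) - f (u + ?z \<theta> *\<^sub>C y) - cblinfun_apply (G (u + ?z \<theta> *\<^sub>C y)) w)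
          \<le> L / \<rho> * (norm w)\<^sup>2"
        by (rule taylor_remainder_estimate[OF f lip \<rho> circ])
          (use circ_w[OF w] in \<open>auto simp: add_ac\<close>)
      then show "norm (?e \<theta> *\<^sub>C f (u + w + ?z \<theta> *\<^sub>C y) - ?e \<theta> *\<^sub>C f (u + ?z \<theta> *\<^sub>C y)
          - ?e \<theta> *\<^sub>C cblinfun_apply (G (u + ?z \<theta> *\<^sub>C y)) w) \<le> L / \<rho> * (norm w)\<^sup>2"
        by (simp add: norm_scaleC add_ac flip: scaleC.diff_right)
    qed
    also have "(2 * pi * r) *\<^sub>R cblinfun_apply (G (u + w)) y - (2 * pi * r) *\<^sub>R cblinfun_apply (G u) y - ?I w
      = (2 * pi * r) *\<^sub>R (cblinfun_apply (G (u + w)) y - cblinfun_apply (G u) y - cblinfun_apply E w)"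
      using r by (simp add: E scaleR_diff_right)
    also have "(L / \<rho> * (norm w)\<^sup>2) * measure lborel {0..2 * pi}
        = (2 * pi * r) * (L / \<rho>\<^sup>2 * norm y * (norm w)\<^sup>2)"
      using False \<rho> by (simp add: r_def power2_eq_square field_simps)
    finally have "(2 * pi * r) * norm (cblinfun_apply (G (u + w)) y - cblinfun_apply (G u) y - cblinfun_apply E w)
      \<le> (2 * pi * r) * (L / \<rho>\<^sup>2 * norm y * (norm w)\<^sup>2)"
      using r by simp
    then show "norm (cblinfun_apply (G (u + w)) y - cblinfun_apply (G u) y - cblinfun_apply E w)
        \<le> L / \<rho>\<^sup>2 * norm y * (norm w)\<^sup>2"
      using r by (subst (asm) mult_le_cancel_left_pos) auto
  qed
qed

text \<open>The derivatives \<open>E y\<close> of \<open>x \<mapsto> G(x)(y)\<close> depend linearly on \<open>y\<close> by uniqueness of derivatives,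
  so they assemble to an operator \<open>D\<close> with \<open>D w y = E y w\<close>. Since the remainders are bounded by a
  multiple of \<open>\<parallel>y\<parallel> \<parallel>w\<parallel>\<^sup>2\<close>, they are quadratic in the operator norm.\<close>

theorem derivative_of_lipschitz_holomorphic:
  fixes f :: "'a::complex_normed_vector \<Rightarrow> 'b::complex_banach"
  assumes U: "open U" "u \<in> U"
    and f: "\<And>x. x \<in> U \<Longrightarrow> (f has_derivative cblinfun_apply (G x)) (at x)"
    and lip: "L-lipschitz_on U f"
  obtains D :: "'a \<Rightarrow>\<^sub>C\<^sub>L 'a \<Rightarrow>\<^sub>C\<^sub>L 'b"
    where "(G has_derivative cblinfun_apply D) (at u)"
proof -
  have L: "0 \<le> L" using lip by (rule lipschitz_on_nonneg)
  obtain d where d: "d > 0" "ball u d \<subseteq> U" using U openE by blast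
  define \<rho> where "\<rho> = d / 3"
  have \<rho>: "\<rho> > 0" "ball u (3 * \<rho>) \<subseteq> U" using d by (simp_all add: \<rho>_def)
  have "\<exists>E::'a \<Rightarrow>\<^sub>C\<^sub>L 'b. norm E \<le> L / \<rho> * norm y \<and> (\<forall>w. norm w < \<rho> \<longrightarrow>
      norm (cblinfun_apply (G (u + w)) y - cblinfun_apply (G u) y - cblinfun_apply E w)
        \<le> L / \<rho>\<^sup>2 * norm y * (norm w)\<^sup>2)" for y
    using pointwise_derivative_exists[OF f lipschitz_on_subset[OF lip \<rho>(2)] \<rho>(1)] \<rho>(2) by (metis subset_eq)
  then obtain E :: "'a \<Rightarrow> 'a \<Rightarrow>\<^sub>C\<^sub>L 'b" where norm_E: "\<And>y. norm (E y) \<le> L / \<rho> * norm y"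
    and rem: "\<And>y w. norm w < \<rho> \<Longrightarrow>
      norm (cblinfun_apply (G (u + w)) y - cblinfun_apply (G u) y - cblinfun_apply (E y) w)
        \<le> L / \<rho>\<^sup>2 * norm y * (norm w)\<^sup>2"
    by metis
  have deriv_E: "((\<lambda>x. cblinfun_apply (G x) y) has_derivative cblinfun_apply (E y)) (at u)" for y
    by (rule has_derivative_of_quadratic_remainder[OF bounded_linear_cblinfun_apply \<rho>(1) rem])
  have E_add: "cblinfun_apply (E (y + y')) w = cblinfun_apply (E y) w + cblinfun_apply (E y') w" for y y' w
    by (rule fun_cong[OF has_derivative_unique[OF deriv_E]])
      (use has_derivative_add[OF deriv_E deriv_E] in \<open>simp add: cblinfun.add_right\<close>)
  have E_scaleC: "cblinfun_apply (E (c *\<^sub>C y)) w = c *\<^sub>C cblinfun_apply (E y) w" for c y w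
    by (rule fun_cong[OF has_derivative_unique[OF deriv_E]])
      (use bounded_linear.has_derivative[OF bounded_linear_scaleC deriv_E] in \<open>simp add: cblinfun_apply_scaleC\<close>)
  have E_scaleR: "cblinfun_apply (E (c *\<^sub>R y)) w = c *\<^sub>R cblinfun_apply (E y) w" for c y w
    using E_scaleC[of "complex_of_real c" y w] by (simp add: scaleC_of_real)
  have norm_E': "norm (cblinfun_apply (E y) w) \<le> L / \<rho> * norm w * norm y" for y w
    using norm_cblinfun_apply_le[of "E y" w] mult_right_mono[OF norm_E[of y] norm_ge_zero[of w]]
    by (simp add: mult_ac)
  have "\<exists>D. cblinfun_apply D = (\<lambda>y. cblinfun_apply (E y) w)" for w
  proof (rule cblinfun_exists[of "\<lambda>y. cblinfun_apply (E y) w"])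
    show "bounded_linear (\<lambda>y. cblinfun_apply (E y) w)"
      by (rule bounded_linear_intro[where K = "L / \<rho> * norm w"])
        (use norm_E' in \<open>auto simp: E_add E_scaleR mult.commute\<close>)
  qed (auto simp: E_scaleC)
  then obtain D0 where D0: "\<And>w. cblinfun_apply (D0 w) = (\<lambda>y. cblinfun_apply (E y) w)" by metis
  have "bounded_linear D0"
  proof (rule bounded_linear_intro[where K = "L / \<rho>"])
    show "norm (D0 w) \<le> norm w * (L / \<rho>)" for w
      using norm_E' L \<rho> by (intro norm_cblinfun_bound) (auto simp: D0 mult_ac)
  qed (auto intro!: cblinfun_eqI simp: D0 cblinfun.add_left cblinfun.scaleR_left cblinfun.add_right cblinfun.scaleR_right)
  moreover have "D0 (c *\<^sub>C w) = c *\<^sub>C D0 w" for c w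
    by (rule cblinfun_eqI) (simp add: D0 scaleC_cblinfun_apply cblinfun_apply_scaleC)
  ultimately obtain D where D: "cblinfun_apply D = D0" using cblinfun_exists by blast
  show thesis
  proof (rule that[of D], rule has_derivative_of_quadratic_remainder[OF bounded_linear_cblinfun_apply \<rho>(1)])
    fix w :: 'a assume w: "norm w < \<rho>"
    show "norm (G (u + w) - G u - cblinfun_apply D w) \<le> L / \<rho>\<^sup>2 * (norm w)\<^sup>2"
      using rem[OF w] L \<rho> by (intro norm_cblinfun_bound) (auto simp: minus_cblinfun_apply D D0 mult_ac)
  qed
qed

section \<open>The isometric isomorphism\<close>

lemma ball_map_differential: "ball_map (differential f)"
  by (simp add: ball_map_def differential_def)

lemma has_derivative_differential:
  assumes "holomorphic_ball f" "x \<in> ball 0 1"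
  shows "(f has_derivative cblinfun_apply (differential f x)) (at x)"
  using assms differential_eqI[OF assms(2)] unfolding holomorphic_ball_def by metis

text \<open>This identifies both sides of the symmetry condition that defines \<open>Hinf_s\<close> with values of
  the derivative of \<open>g\<close>.\<close>

lemma eval_comp_differential_eval_comp:
  assumes g: "(g has_derivative cblinfun_apply D) (at u)" and u: "u \<in> ball 0 1"
  shows "eval_comp y (differential (eval_comp x g)) u = cblinfun_apply (cblinfun_apply D y) x"
proof -
  have "bounded_linear (\<lambda>w. cblinfun_apply (cblinfun_apply D w) x)"
    by (rule bounded_linear_compose[OF cblinfun.bounded_linear_left bounded_linear_cblinfun_apply])
  then obtain E where E: "cblinfun_apply E = (\<lambda>w. cblinfun_apply (cblinfun_apply D w) x)"
    using cblinfun_exists[of "\<lambda>w. cblinfun_apply (cblinfun_apply D w) x"]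
    by (auto simp: cblinfun_apply_scaleC scaleC_cblinfun_apply)
  have "(eval_comp x g has_derivative cblinfun_apply E) (at u)"
    unfolding eval_comp_def E by (rule bounded_linear.has_derivative[OF cblinfun.bounded_linear_left g])
  then have "differential (eval_comp x g) u = E" by (rule differential_eqI[OF u])
  then show ?thesis by (simp add: eval_comp_def E)
qed

lemma eval_comp_differential_outside:
  "u \<notin> ball 0 1 \<Longrightarrow> eval_comp y (differential h) u = 0"
  by (simp add: eval_comp_def differential_def cblinfun.zero_left)

lemma differential_in_Hinf_s:
  fixes f :: "'a::complex_banach \<Rightarrow> 'b::complex_banach"
  assumes "f \<in> HL0"
  shows "differential f \<in> Hinf_s"
proof -
  obtain L where hol: "holomorphic_ball f" and lip: "L-lipschitz_on (ball 0 1) f"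
    using assms by (auto simp: HL0_def Hinf_def)
  note f = has_derivative_differential[OF hol]
  have D: "\<exists>D. (differential f has_derivative cblinfun_apply D) (at u)" if "u \<in> ball 0 1" for u
    using derivative_of_lipschitz_holomorphic[OF open_ball that f lip] by blast
  have "norm (differential f x) \<le> L" if "x \<in> ball 0 1" for x
    by (rule norm_derivative_le_lipschitz[OF open_ball that lip f[OF that]])
  then have "bounded (differential f ` ball 0 1)" unfolding bounded_iff by blast
  then have "differential f \<in> Hinf"
    using D by (simp add: Hinf_def ball_map_differential holomorphic_ball_def)
  moreover have "eval_comp y (differential (eval_comp x (differential f)))
      = eval_comp x (differential (eval_comp y (differential f)))" for x y
  proof
    fix u :: 'a
    show "eval_comp y (differential (eval_comp x (differential f))) u
      = eval_comp x (differential (eval_comp y (differential f))) u"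
    proof (cases "u \<in> ball 0 1")
      case True
      then obtain D where D: "(differential f has_derivative cblinfun_apply D) (at u)" using D by blast
      have "((\<lambda>x. blinfun_of_cblinfun (differential f x)) has_derivative
          (\<lambda>w. blinfun_of_cblinfun (cblinfun_apply D w))) (at u)"
        by (rule bounded_linear.has_derivative[OF bounded_linear_blinfun_of_cblinfun D])
      from second_derivative_symmetric[OF open_ball True _ this, of f y x]
      have "cblinfun_apply (cblinfun_apply D y) x = cblinfun_apply (cblinfun_apply D x) y"
        using f by (simp add: cblinfun_apply_eq_blinfun)
      then show ?thesis by (simp add: eval_comp_differential_eval_comp[OF D True])
    qed (simp add: eval_comp_differential_outside)
  qed
  ultimately show ?thesis by (simp add: Hinf_s_def)
qed

lemma lipschitz_on_ball_of_norm_differential_le: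
  assumes hol: "holomorphic_ball f" and B: "\<And>x. x \<in> ball 0 1 \<Longrightarrow> norm (differential f x) \<le> B"
  shows "B-lipschitz_on (ball 0 1) f"
proof (rule lipschitz_onI)
  show B0: "0 \<le> B" using order_trans[OF norm_ge_zero B[of 0]] by simp
  fix x y :: 'a assume xy: "x \<in> ball 0 1" "y \<in> ball 0 1"
  show "dist (f x) (f y) \<le> B * dist x y"
    unfolding dist_norm
  proof (rule differentiable_bound[OF convex_ball _ _ xy])
    fix z :: 'a assume z: "z \<in> ball 0 1"
    show "(f has_derivative cblinfun_apply (differential f z)) (at z within ball 0 1)"
      using has_derivative_differential[OF hol z] by (rule has_derivative_at_withinI)
    show "onorm (cblinfun_apply (differential f z)) \<le> B"
      by (rule onorm_bound[OF B0])
        (rule order_trans[OF norm_cblinfun_apply_le mult_right_mono[OF B[OF z] norm_ge_zero]])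
  qed
qed

lemma Hinf_norm_differential:
  fixes f :: "'a::complex_normed_vector \<Rightarrow> 'b::complex_normed_vector"
  assumes "f \<in> HL0"
  shows "Hinf_norm (differential f) = Lip_norm f"
proof -
  obtain C where hol: "holomorphic_ball f" and C: "C-lipschitz_on (ball 0 1) f"
    using assms by (auto simp: HL0_def Hinf_def)
  let ?Q = "insert 0 {norm (f x - f y) / norm (x - y) | x y. x \<in> ball 0 1 \<and> y \<in> ball 0 1 \<and> x \<noteq> y}"
  have Q_le: "q \<le> M" if lip: "M-lipschitz_on (ball 0 1) f" and "q \<in> ?Q" for q M
    using that(2) lipschitz_on_nonneg[OF lip] lipschitz_on_normD[OF lip]
    by (auto simp: pos_divide_le_eq)
  have bdd_Q: "bdd_above ?Q" using Q_le[OF C] by (rule bdd_aboveI)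
  have lip: "(Lip_norm f)-lipschitz_on (ball 0 1) f"
  proof (rule lipschitz_onI)
    show "0 \<le> Lip_norm f" unfolding Lip_norm_def by (rule cSup_upper[OF _ bdd_Q]) simp
    fix x y :: 'a assume xy: "x \<in> ball 0 1" "y \<in> ball 0 1"
    show "dist (f x) (f y) \<le> Lip_norm f * dist x y"
    proof (cases "x = y")
      case False
      then have "norm (f x - f y) / norm (x - y) \<le> Lip_norm f"
        unfolding Lip_norm_def using xy by (intro cSup_upper[OF _ bdd_Q]) blast
      then show ?thesis using False by (simp add: dist_norm pos_divide_le_eq)
    qed simp
  qed
  have le: "norm (differential f x) \<le> Lip_norm f" if "x \<in> ball 0 1" for x
    by (rule norm_derivative_le_lipschitz[OF open_ball that lip has_derivative_differential[OF hol that]])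
  show ?thesis
  proof (rule antisym)
    show "Hinf_norm (differential f) \<le> Lip_norm f"
      unfolding Hinf_norm_def by (rule cSUP_least) (use le in auto)
    have "norm (differential f x) \<le> Hinf_norm (differential f)" if "x \<in> ball 0 1" for x
      unfolding Hinf_norm_def by (rule cSUP_upper[OF that bdd_aboveI2]) (rule le)
    then have "(Hinf_norm (differential f))-lipschitz_on (ball 0 1) f"
      by (rule lipschitz_on_ball_of_norm_differential_le[OF hol])
    then show "Lip_norm f \<le> Hinf_norm (differential f)"
      unfolding Lip_norm_def by (intro cSup_least) (use Q_le in auto)
  qed
qed

text \<open>Read through evaluation maps, the symmetry condition says that \<open>g\<close> is a closed 1-form, so it
  has a primitive on the ball. Normalised to vanish at \<open>0\<close>, the primitive is Lipschitz because \<open>g\<close> is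
  bounded, and bounded because the ball is.\<close>

lemma differential_surj:
  fixes g :: "'a::complex_banach \<Rightarrow> 'a \<Rightarrow>\<^sub>C\<^sub>L 'b::complex_banach"
  assumes "g \<in> Hinf_s"
  obtains f where "f \<in> HL0" "differential f = g"
proof -
  have ball_g: "ball_map g" and hol_g: "holomorphic_ball g" and bdd_g: "bounded (g ` ball 0 1)"
    and sym_g: "\<And>x y. eval_comp y (differential (eval_comp x g)) = eval_comp x (differential (eval_comp y g))"
    using assms by (auto simp: Hinf_s_def Hinf_def)
  define \<omega> where "\<omega> x = blinfun_of_cblinfun (g x)" for x
  define D where "D x v = blinfun_of_cblinfun (cblinfun_apply (differential g x) v)" for x v
  obtain F where F: "\<And>x. x \<in> ball 0 1 \<Longrightarrow> (F has_derivative blinfun_apply (\<omega> x)) (at x within ball 0 1)"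
  proof (rule symmetric_derivative_imp_primitive[of "ball 0 1" \<omega> D])
    fix x :: 'a assume x: "x \<in> ball 0 1"
    note g = has_derivative_differential[OF hol_g x]
    show "(\<omega> has_derivative D x) (at x within ball 0 1)"
      unfolding \<omega>_def D_def
      by (rule has_derivative_at_withinI) (rule bounded_linear.has_derivative[OF bounded_linear_blinfun_of_cblinfun g])
    show "blinfun_apply (D x v) w = blinfun_apply (D x w) v" for v w
      using fun_cong[OF sym_g[of v w], of x]
      by (simp add: eval_comp_differential_eval_comp[OF g x] D_def cblinfun_apply_eq_blinfun)
  qed (auto intro: that)
  define f where "f x = (if x \<in> ball 0 1 then F x - F 0 else 0)" for x
  have f: "(f has_derivative cblinfun_apply (g x)) (at x)" if x: "x \<in> ball 0 1" for x
  proof -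
    have "(F has_derivative cblinfun_apply (g x)) (at x)"
      using F[OF x] at_within_open[OF x open_ball] by (simp add: \<omega>_def cblinfun_apply_eq_blinfun)
    then have "((\<lambda>y. F y - F 0) has_derivative cblinfun_apply (g x)) (at x)"
      using has_derivative_diff[OF _ has_derivative_const] by fastforce
    then show ?thesis
      by (rule has_derivative_transform_within_open[OF _ open_ball x]) (simp add: f_def)
  qed
  then have hol: "holomorphic_ball f" unfolding holomorphic_ball_def by blast
  have dfg: "differential f = g"
  proof
    show "differential f x = g x" for x
      using differential_eqI[OF _ f, of x] ball_g by (cases "x \<in> ball 0 1") (auto simp: ball_map_def differential_def)
  qed
  obtain B where "\<And>x. x \<in> ball 0 1 \<Longrightarrow> norm (g x) \<le> B"
    using bdd_g unfolding bounded_iff by blast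
  then have lip: "B-lipschitz_on (ball 0 1) f"
    using lipschitz_on_ball_of_norm_differential_le[OF hol] by (simp add: dfg)
  have f0: "f 0 = 0" by (simp add: f_def)
  have "norm (f x) \<le> B" if "x \<in> ball 0 1" for x
  proof -
    have "norm (f x) \<le> B * norm x" using lipschitz_on_normD[OF lip that, of 0] by (simp add: f0)
    also have "\<dots> \<le> B * 1" using that lipschitz_on_nonneg[OF lip] by (intro mult_left_mono) auto
    finally show ?thesis by simp
  qed
  then have "bounded (f ` ball 0 1)" unfolding bounded_iff by blast
  with hol lip f0 have "f \<in> HL0"
    by (auto simp: HL0_def Hinf_def ball_map_def f_def)
  then show thesis using dfg by (rule that)
qed

theorem theorem3p9:
  shows "isometric_isomorphism
    (HL0 :: ('a::complex_banach \<Rightarrow> 'b::complex_banach) set) Lip_norm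
    (Hinf_s :: ('a \<Rightarrow> ('a \<Rightarrow>\<^sub>C\<^sub>L 'b)) set) Hinf_norm
    differential"
  unfolding isometric_isomorphism_def
proof (intro conjI allI ballI)
  fix f g :: "'a \<Rightarrow> 'b" and c :: complex
  assume f: "f \<in> HL0"
  then have hol_f: "holomorphic_ball f" by (simp add: HL0_def Hinf_def)
  show "differential f \<in> Hinf_s" using f by (rule differential_in_Hinf_s)
  show "Hinf_norm (differential f) = Lip_norm f" using f by (rule Hinf_norm_differential)
  show "differential (\<lambda>x. c *\<^sub>C f x) = (\<lambda>x. c *\<^sub>C differential f x)"
  proof
    fix x :: 'a
    show "differential (\<lambda>x. c *\<^sub>C f x) x = c *\<^sub>C differential f x"
    proof (cases "x \<in> ball 0 1")
      case True
      then show ?thesis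
        using bounded_linear.has_derivative[OF bounded_linear_scaleC has_derivative_differential[OF hol_f True]]
        by (intro differential_eqI) (simp_all add: scaleC_cblinfun_apply[abs_def])
    qed (simp add: differential_def)
  qed
  assume g: "g \<in> HL0"
  then have hol_g: "holomorphic_ball g" by (simp add: HL0_def Hinf_def)
  show "differential (\<lambda>x. f x + g x) = (\<lambda>x. differential f x + differential g x)"
  proof
    fix x :: 'a
    show "differential (\<lambda>x. f x + g x) x = differential f x + differential g x"
    proof (cases "x \<in> ball 0 1")
      case True
      then show ?thesis
        using has_derivative_add[OF has_derivative_differential[OF hol_f True] has_derivative_differential[OF hol_g True]]
        by (intro differential_eqI) (simp_all add: plus_cblinfun_apply[abs_def])
    qed (simp add: differential_def)
  qed
next
  fix g :: "'a \<Rightarrow> 'a \<Rightarrow>\<^sub>C\<^sub>L 'b" assume "g \<in> Hinf_s"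
  then show "\<exists>f\<in>HL0. differential f = g" using differential_surj by blast
qed

end
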